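(* There is an absolute constant $C>0$ such that the following holds. For every $\varepsilon\in(0,1)$, every $n\geqslant 2$, all item sizes $s_1,\ldots,s_n\in\mathbb{R}_+$ and every demand $D\in\mathbb{R}_+$, there exists an extended formulation of size at most $(1/\varepsilon)^{C}n^{C\log n}$ defining an LP relaxation of the min-knapsack problem with item sizes $s_1,\dots,s_n$ and demand $D$ whose integrality gap is at most $2+\varepsilon$.
   Context: Min-knapsack: given positive item sizes $s_1,\dots,s_n$, a positive demand $D$ and nonnegative costs $c_1,\dots,c_n$, solve $\min\{\sum_{i=1}^n c_ix_i \mid \sum_{i=1}^n s_ix_i\geqslant D,\ x\in\{0,1\}^n\}$. Let $P$ be the min-knapsack polytope, i.e. the convex hull of the feasible points $\{x\in\{0,1\}^n\mid \sum_i s_ix_i\geqslant D\}$ (assumed nonempty). An extended formulation is a system $E^{\leqslant}x+F^{\leqslant}y\leqslant g^{\leqslant}$, $E^{=}x+F^{=}y=g^{=}$ in variables $(x,y)\in\mathbb{R}^{n+k}$; its size is the number of inequalities; it defines the polyhedron $R=\{x\in\mathbb{R}^n\mid \exists y: E^{\leqslant}x+F^{\leqslant}y\leqslant g^{\leqslant},\ E^{=}x+F^{=}y=g^{=}\}$. It defines an LP relaxation of min-knapsack if $P\subseteq R$; the relaxation depends only on the sizes and the demand, not on the costs. Its integrality gap is the supremum, over all nonnegative cost vectors $c$, of the ratio of $\min\{c^\intercal x\mid x\in P\}$ to $\min\{c^\intercal x\mid x\in R\}$ (i.e. the claim means that for every $c\in\mathbb{R}^n_{\geqslant0}$ the integer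 optimum is at most $(2+\varepsilon)\min\{c^\intercal x\mid x\in R\}$). *)

theory Defs
  imports "HOL-Analysis.Analysis"
begin

text \<open>Vectors in R^n are represented as functions nat => real; only the coordinates
  0..n-1 are meaningful, and points of R^n are required to vanish outside {..<n}.\<close>

definition knap_feasible :: "nat \<Rightarrow> (nat \<Rightarrow> real) \<Rightarrow> real \<Rightarrow> (nat \<Rightarrow> real) set" where
  "knap_feasible n s D =
     {x. (\<forall>j<n. x j \<in> {0, 1}) \<and> (\<forall>j\<ge>n. x j = 0) \<and> (\<Sum>j<n. s j * x j) \<ge> D}"

definition knap_polytope :: "nat \<Rightarrow> (nat \<Rightarrow> real) \<Rightarrow> real \<Rightarrow> (nat \<Rightarrow> real) set" where
  "knap_polytope n s D =
     {x. \<exists>S u. finite S \<and> S \<subseteq> knap_feasible n s D \<and> (\<forall>v\<in>S. u v \<ge> 0) \<and>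
               (\<Sum>v\<in>S. u v) = 1 \<and> x = (\<lambda>j. \<Sum>v\<in>S. u v * v j)}"

definition ext_form_proj ::
  "nat \<Rightarrow> nat \<Rightarrow> nat \<Rightarrow> nat \<Rightarrow>
   (nat \<Rightarrow> nat \<Rightarrow> real) \<Rightarrow> (nat \<Rightarrow> nat \<Rightarrow> real) \<Rightarrow> (nat \<Rightarrow> real) \<Rightarrow>
   (nat \<Rightarrow> nat \<Rightarrow> real) \<Rightarrow> (nat \<Rightarrow> nat \<Rightarrow> real) \<Rightarrow> (nat \<Rightarrow> real) \<Rightarrow> (nat \<Rightarrow> real) set" where
  "ext_form_proj n k m p Ele Fle gle Eeq Feq geq =
     {x. (\<forall>j\<ge>n. x j = 0) \<and>
         (\<exists>y::nat \<Rightarrow> real.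
            (\<forall>i<m. (\<Sum>j<n. Ele i j * x j) + (\<Sum>j<k. Fle i j * y j) \<le> gle i) \<and>
            (\<forall>i<p. (\<Sum>j<n. Eeq i j * x j) + (\<Sum>j<k. Feq i j * y j) = geq i))}"

definition lin_cost :: "nat \<Rightarrow> (nat \<Rightarrow> real) \<Rightarrow> (nat \<Rightarrow> real) \<Rightarrow> real" where
  "lin_cost n c x = (\<Sum>j<n. c j * x j)"

end

theory Submission
  imports Defs
begin

text \<open>
  The relaxation is the projection of a system obtained from monotone formulas for weighted
  thresholds, each gate acting on cones: conjunction is intersection, disjunction is Minkowski sum.
  Working with homogenised points \<open>(x, \<lambda>)\<close>, where \<open>\<lambda>\<close> is stored in coordinate \<open>n\<close>, makes both operations
  preserve valid homogeneous inequalities and add up the sizes, with no closure to take.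

  A threshold \<open>\<Sum>w\<^sub>i x\<^sub>i \<ge> T\<close> with real weights is first replaced by an equivalent one with weights of
  polynomially many bits (Frank and Tardos, by simultaneous Diophantine approximation). Scanning the bits
  from the top, it holds iff one can walk through levels of \<open>n + 2\<close> states, each step being an
  unweighted threshold on one bit; this reachability problem is solved by recursive bisection as in
  Savitch's theorem, which gives size \<open>n^O(log n)\<close>. For every set \<open>A\<close> violating the threshold, the
  resulting cone satisfies \<open>\<Sum>\<^bsub>i\<notin>A\<^esub> x\<^sub>i \<ge> \<lambda>\<close>.

  Knapsack cover inequalities, up to a factor \<open>1 - \<epsilon>/3\<close>, then come from guessing the weight of the
  items of size at most \<open>\<theta>\<close> to precision \<open>\<epsilon>\<theta>/3\<close> and imposing the remaining demand on the large
  items as a threshold, for each \<open>\<theta>\<close> among \<open>0\<close> and the item sizes. Rounding up the coordinates with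
  \<open>x\<^sub>i \<ge> 1/(2 + \<epsilon>)\<close> and rounding the residual knapsack at a point with at most one fractional
  coordinate gives the gap.
\<close>

subsection \<open>Integer weights for real thresholds\<close>

lemma abs_sum_mult_le:
  fixes a x :: "'a \<Rightarrow> 'b::linordered_idom"
  assumes "\<And>i. i \<in> I \<Longrightarrow> \<bar>a i\<bar> \<le> B" and "(\<Sum>i\<in>I. \<bar>x i\<bar>) \<le> N" and "0 \<le> B"
  shows "\<bar>\<Sum>i\<in>I. a i * x i\<bar> \<le> B * N"
proof -
  have "\<bar>\<Sum>i\<in>I. a i * x i\<bar> \<le> (\<Sum>i\<in>I. \<bar>a i * x i\<bar>)" by (rule sum_abs)
  also have "\<dots> \<le> (\<Sum>i\<in>I. B * \<bar>x i\<bar>)"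
    by (intro sum_mono) (simp add: abs_mult assms(1) mult_right_mono)
  also have "\<dots> = B * (\<Sum>i\<in>I. \<bar>x i\<bar>)" by (simp add: sum_distrib_left)
  also have "\<dots> \<le> B * N" using assms(2,3) by (rule mult_left_mono)
  finally show ?thesis .
qed

lemma sgn_add_dominant:
  fixes a b :: "'a::linordered_idom"
  assumes "\<bar>b\<bar> < \<bar>a\<bar>"
  shows "sgn (a + b) = sgn a"
  using assms by (auto simp: sgn_if abs_if split: if_splits)

text \<open>Approximate \<open>w / max \<bar>w\<bar>\<close> by \<open>p / q\<close>: the remainder has one zero entry more, and it decides
  the sign exactly where \<open>p \<bullet> x = 0\<close>, so it may be treated recursively with \<open>p\<close> weighted dominantly.\<close>

lemma sign_preserving_integer_weights:
  fixes w :: "nat \<Rightarrow> real" and N m z :: nat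
  assumes N: "N > 0" and "card {i. i < m \<and> w i \<noteq> 0} \<le> z"
  shows "\<exists>W::nat \<Rightarrow> int. (\<forall>i<m. \<bar>W i\<bar> < int ((N ^ Suc m + 1) ^ z)) \<and>
    (\<forall>x::nat \<Rightarrow> int. (\<Sum>i<m. \<bar>x i\<bar>) \<le> int N \<longrightarrow>
       real_of_int (sgn (\<Sum>i<m. W i * x i)) = sgn (\<Sum>i<m. w i * real_of_int (x i)))"
  using assms(2)
proof (induction z arbitrary: w)
  case 0
  then have "w i = 0" if "i < m" for i using that by auto
  then show ?case by (intro exI[of _ "\<lambda>_. 0"]) simp
next
  case (Suc z)
  show ?case
  proof (cases "\<exists>i<m. w i \<noteq> 0")
    case False
    then show ?thesis by (intro exI[of _ "\<lambda>_. 0"]) (simp add: add_pos_nonneg del: power_Suc)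
  next
    case True
    define M where "M = Max ((\<lambda>i. \<bar>w i\<bar>) ` {..<m})"
    have "m > 0" using True by auto
    have "M \<in> (\<lambda>i. \<bar>w i\<bar>) ` {..<m}"
      unfolding M_def using \<open>m > 0\<close> by (intro Max_in) auto
    then obtain i0 where i0: "i0 < m" "\<bar>w i0\<bar> = M" by auto
    have wM: "\<bar>w i\<bar> \<le> M" if "i < m" for i
      unfolding M_def using that by (intro Max_ge) auto
    have "M > 0" using True wM by (meson less_le_trans zero_less_abs_iff)
    define u where "u = (\<lambda>i. w i / M)"
    have w_eq: "w i = M * u i" for i using \<open>M > 0\<close> by (simp add: u_def)
    have u1: "\<bar>u i\<bar> \<le> 1" if "i < m" for i
      using wM[OF that] \<open>M > 0\<close> by (simp add: u_def)
    \<comment> \<open>Simultaneous Dirichlet approximation: one denominator \<open>q\<close>, at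
      most \<open>N ^ m\<close>, brings the errors of all \<open>m\<close> numbers
      \<open>u i\<close> below \<open>1 / N\<close>.\<close>
    obtain q p where q: "0 < q" "q \<le> int (N ^ m)"
      and p: "\<And>i. i < m \<Longrightarrow> \<bar>of_int q * u i - of_int (p i)\<bar> < 1 / N"
      using Dirichlet_approx_simult[OF N, of m u] by metis
    have p1: "\<bar>of_int q * u i - of_int (p i)\<bar> < 1" if "i < m" for i
    proof -
      have "1 / real N \<le> 1" using N by simp
      then show ?thesis using p[OF that] by linarith
    qed
    define w' where "w' = (\<lambda>i. of_int q * u i - of_int (p i))"
    have w'0: "w' i = 0" if "i < m" "w i = 0" for i
      using p1[OF that(1)] that(2) by (simp add: w'_def u_def)
    \<comment> \<open>At a largest weight \<open>u i0\<close> is 1 or -1, so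
      \<open>of_int q * u i0\<close> is an integer at distance less than 1 from \<open>p i0\<close>.
      This vanishing entry drives the induction on \<open>z\<close>.\<close>
    have "w' i0 = 0"
    proof -
      have "u i0 = 1 \<or> u i0 = -1" using i0 \<open>M > 0\<close> by (auto simp: u_def abs_if split: if_splits)
      then show ?thesis
      proof
        assume "u i0 = 1"
        with p1[OF i0(1)] have "\<bar>real_of_int (q - p i0)\<bar> < 1" by simp
        then have "\<bar>q - p i0\<bar> < 1" by linarith
        then show ?thesis using \<open>u i0 = 1\<close> by (simp add: w'_def)
      next
        assume "u i0 = -1"
        with p1[OF i0(1)] have "\<bar>real_of_int (- q - p i0)\<bar> < 1" by simp
        then have "\<bar>- q - p i0\<bar> < 1" by linarith
        then have "p i0 = - q" by linarith
        then show ?thesis using \<open>u i0 = -1\<close> by (simp add: w'_def)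
      qed
    qed
    have "{i. i < m \<and> w' i \<noteq> 0} \<subseteq> {i. i < m \<and> w i \<noteq> 0} - {i0}"
      using w'0 \<open>w' i0 = 0\<close> by auto
    then have "card {i. i < m \<and> w' i \<noteq> 0} \<le> card ({i. i < m \<and> w i \<noteq> 0} - {i0})"
      by (intro card_mono) auto
    also have "\<dots> < card {i. i < m \<and> w i \<noteq> 0}"
      using i0 \<open>M > 0\<close> by (intro card_Diff1_less) auto
    finally have "card {i. i < m \<and> w' i \<noteq> 0} \<le> z" using Suc.prems by linarith
    from Suc.IH[OF this] obtain W' where
      W'b: "\<And>i. i < m \<Longrightarrow> \<bar>W' i\<bar> < int ((N ^ Suc m + 1) ^ z)" and
      W's: "\<And>x::nat \<Rightarrow> int. (\<Sum>i<m. \<bar>x i\<bar>) \<le> int N \<Longrightarrow>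
         real_of_int (sgn (\<Sum>i<m. W' i * x i)) = sgn (\<Sum>i<m. w' i * real_of_int (x i))"
      by blast
    define B where "B = int ((N ^ Suc m + 1) ^ z)"
    have "B \<ge> 1" unfolding B_def by simp
    \<comment> \<open>The factor \<open>N * B\<close> makes \<open>p\<close> dominant: integers with
      \<open>\<bar>W' i\<bar> < B\<close> contribute at most \<open>(B - 1) * N\<close>. Since
      \<open>\<bar>p i\<bar>\<close> is at most \<open>N ^ m\<close>, the bound grows by
      \<open>N ^ Suc m + 1\<close> per round.\<close>
    define W where "W = (\<lambda>i. int N * B * p i + W' i)"
    have pq: "\<bar>p i\<bar> \<le> int (N ^ m)" if "i < m" for i
    proof -
      have "\<bar>real_of_int q * u i\<bar> \<le> real_of_int q"
        using u1[OF that] q(1) by (simp add: abs_mult mult_left_le)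
      then have "real_of_int \<bar>p i\<bar> < real_of_int q + 1" using p1[OF that] by linarith
      then have "\<bar>p i\<bar> \<le> q" by linarith
      then show ?thesis using q(2) by linarith
    qed
    have Wb: "\<bar>W i\<bar> < int ((N ^ Suc m + 1) ^ Suc z)" if "i < m" for i
    proof -
      have "\<bar>W i\<bar> \<le> \<bar>int N * B * p i\<bar> + \<bar>W' i\<bar>" unfolding W_def by (rule abs_triangle_ineq)
      also have "\<bar>int N * B * p i\<bar> = int N * B * \<bar>p i\<bar>" using \<open>B \<ge> 1\<close> by (simp add: abs_mult)
      also have "\<dots> \<le> int N * B * int (N ^ m)"
        using \<open>B \<ge> 1\<close> pq[OF that] by (intro mult_left_mono) auto
      also have "int N * B * int (N ^ m) + \<bar>W' i\<bar> < int N * B * int (N ^ m) + B"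
        using W'b[OF that] by (simp add: B_def)
      also have "\<dots> = int ((N ^ Suc m + 1) ^ Suc z)" by (simp add: B_def algebra_simps)
      finally show ?thesis by simp
    qed
    have Ws: "real_of_int (sgn (\<Sum>i<m. W i * x i)) = sgn (\<Sum>i<m. w i * real_of_int (x i))"
      if x: "(\<Sum>i<m. \<bar>x i\<bar>) \<le> int N" for x :: "nat \<Rightarrow> int"
    proof -
      define P where "P = (\<Sum>i<m. p i * x i)"
      define r where "r = (\<Sum>i<m. w' i * real_of_int (x i))"
      define R where "R = (\<Sum>i<m. W' i * x i)"
      have xr: "(\<Sum>i<m. \<bar>real_of_int (x i)\<bar>) \<le> real N"
      proof -
        have "(\<Sum>i<m. \<bar>real_of_int (x i)\<bar>) = real_of_int (\<Sum>i<m. \<bar>x i\<bar>)" by simp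
        also have "\<dots> \<le> real N" using x by linarith
        finally show ?thesis .
      qed
      have WP: "(\<Sum>i<m. W i * x i) = int N * B * P + R"
        by (simp add: W_def P_def R_def algebra_simps sum.distrib sum_distrib_left)
      have wP: "(\<Sum>i<m. w i * real_of_int (x i)) = M / of_int q * (of_int P + r)"
      proof -
        have "M / of_int q * (of_int P + r) = (\<Sum>i<m. M / of_int q * ((of_int (p i) + w' i) * of_int (x i)))"
          by (simp add: P_def r_def algebra_simps sum.distrib sum_distrib_left)
        also have "\<dots> = (\<Sum>i<m. w i * real_of_int (x i))"
          using q(1) by (intro sum.cong) (simp_all add: w'_def w_eq)
        finally show ?thesis by simp
      qed
      have sw: "sgn (\<Sum>i<m. w i * real_of_int (x i)) = sgn (of_int P + r)"
        unfolding wP using \<open>M > 0\<close> q(1) by (simp add: sgn_mult)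
      show ?thesis
      proof (cases "P = 0")
        case True
        then show ?thesis using W's[OF x] by (simp add: sw WP R_def r_def)
      next
        case False
        have "\<bar>r\<bar> < 1"
        proof -
          \<comment> \<open>Passing to the largest error keeps the estimate strict:
            \<open>\<mu> * N < 1\<close>, although the sum is only bounded weakly.\<close>
          define \<mu> where "\<mu> = Max ((\<lambda>i. \<bar>w' i\<bar>) ` {..<m})"
          have "\<mu> \<in> (\<lambda>i. \<bar>w' i\<bar>) ` {..<m}"
            unfolding \<mu>_def using \<open>m > 0\<close> by (intro Max_in) auto
          then have \<mu>: "\<mu> < 1 / N" "\<mu> \<ge> 0" using p by (auto simp: w'_def)
          have "\<bar>w' i\<bar> \<le> \<mu>" if "i < m" for i
            unfolding \<mu>_def using that by (intro Max_ge) auto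
          then have "\<bar>r\<bar> \<le> \<mu> * N"
            unfolding r_def using xr \<mu>(2) by (intro abs_sum_mult_le) auto
          also have "\<dots> < 1" using \<mu>(1) N by (simp add: field_simps)
          finally show ?thesis .
        qed
        also have "1 \<le> \<bar>real_of_int P\<bar>" using False by linarith
        finally have 1: "sgn (of_int P + r) = sgn (real_of_int P)" by (rule sgn_add_dominant)
        have "\<bar>R\<bar> \<le> (B - 1) * int N"
          unfolding R_def using W'b x \<open>B \<ge> 1\<close>
          by (intro abs_sum_mult_le) (auto simp: B_def int_one_le_iff_zero_less)
        also have "\<dots> < int N * B" using N by (simp add: algebra_simps)
        also have "\<dots> \<le> int N * B * \<bar>P\<bar>"
          using False \<open>B \<ge> 1\<close> mult_left_mono[of 1 "\<bar>P\<bar>" "int N * B"] by simp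
        also have "\<dots> = \<bar>int N * B * P\<bar>" using \<open>B \<ge> 1\<close> by (simp add: abs_mult)
        finally have "sgn (int N * B * P + R) = sgn (int N * B * P)" by (rule sgn_add_dominant)
        also have "\<dots> = sgn P" using N \<open>B \<ge> 1\<close> by (simp add: sgn_mult)
        finally have "sgn (int N * B * P + R) = sgn P" .
        moreover have "real_of_int (sgn P) = sgn (real_of_int P)" by (simp add: sgn_if)
        ultimately show ?thesis using 1 by (simp add: sw WP)
      qed
    qed
    show ?thesis using Wb Ws by blast
  qed
qed

subsection \<open>Projections of homogeneous systems\<close>

text \<open>The size is \<open>m\<close>, the number of inequalities; the number \<open>k\<close> of
  auxiliary variables is left free. Coordinates from \<open>N\<close> on are unconstrained, so
  \<open>K\<close> is a cylinder over its first \<open>N\<close> coordinates.\<close>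

definition proj_cone :: "nat \<Rightarrow> (nat \<Rightarrow> real) set \<Rightarrow> nat \<Rightarrow> bool" where
  "proj_cone N K m \<longleftrightarrow> (\<exists>(k::nat) A B. K = {z. \<exists>y. \<forall>i<m.
     (\<Sum>j<N. A i j * z j) + (\<Sum>j<k. B i j * y j) \<ge> (0::real)})"

definition mink_sum :: "(nat \<Rightarrow> real) set \<Rightarrow> (nat \<Rightarrow> real) set \<Rightarrow> (nat \<Rightarrow> real) set" where
  "mink_sum K L = {z. \<exists>u\<in>K. (\<lambda>j. z j - u j) \<in> L}"

lemma proj_cone_zero:
  assumes "proj_cone N K m" shows "(\<lambda>_. 0) \<in> K"
  using assms by (auto simp: proj_cone_def intro: exI[of _ "\<lambda>_. 0"])

lemma proj_cone_halfspaces: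
  "proj_cone N {z. \<forall>i<m. (\<Sum>j<N. A i j * z j) \<ge> 0} m"
  unfolding proj_cone_def by (rule exI[of _ 0], rule exI[of _ A], rule exI[of _ "\<lambda>_ _. 0"]) simp

lemma all_less_add_iff: "(\<forall>i<m + k. P i) \<longleftrightarrow> (\<forall>i<m. P i) \<and> (\<forall>i<k. P (m + i))" for m k :: nat
  by (metis add_less_cancel_left le_add_diff_inverse less_diff_conv2 not_less trans_less_add1 add.commute)

lemma sum_lessThan_add: "(\<Sum>j<m + k. f j) = (\<Sum>j<m. f j) + (\<Sum>j<k. f (m + j))"
  for f :: "nat \<Rightarrow> 'a::comm_monoid_add"
  by (induction k) (simp_all add: add.assoc)

text \<open>The two systems are stacked and their auxiliary vectors concatenated, the second one
  starting at position \<open>k1\<close>.\<close>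

lemma proj_cone_Int:
  assumes "proj_cone N K1 m1" and "proj_cone N K2 m2"
  shows "proj_cone N (K1 \<inter> K2) (m1 + m2)"
proof -
  from assms(1) obtain k1 :: nat and A1 B1 where K1: "K1 = {z. \<exists>y. \<forall>i<m1.
     (\<Sum>j<N. A1 i j * z j) + (\<Sum>j<k1. B1 i j * y j) \<ge> (0::real)}" unfolding proj_cone_def by blast
  from assms(2) obtain k2 :: nat and A2 B2 where K2: "K2 = {z. \<exists>y. \<forall>i<m2.
     (\<Sum>j<N. A2 i j * z j) + (\<Sum>j<k2. B2 i j * y j) \<ge> (0::real)}" unfolding proj_cone_def by blast
  define A where "A = (\<lambda>i. if i < m1 then A1 i else A2 (i - m1))"
  define B where "B = (\<lambda>i j. if i < m1 then (if j < k1 then B1 i j else 0)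
                              else (if j < k1 then 0 else B2 (i - m1) (j - k1)))"
  define S where "S = (\<lambda>z y. \<forall>i<m1 + m2.
     (\<Sum>j<N. A i j * z j) + (\<Sum>j<k1 + k2. B i j * y j) \<ge> (0::real))"
  have S: "S z y \<longleftrightarrow>
     (\<forall>i<m1. (\<Sum>j<N. A1 i j * z j) + (\<Sum>j<k1. B1 i j * y j) \<ge> 0) \<and>
     (\<forall>i<m2. (\<Sum>j<N. A2 i j * z j) + (\<Sum>j<k2. B2 i j * y (k1 + j)) \<ge> 0)" for z y
    by (simp add: S_def all_less_add_iff sum_lessThan_add A_def B_def)
  have "K1 \<inter> K2 = {z. \<exists>y. S z y}"
  proof (intro equalityI subsetI)
    fix z assume "z \<in> K1 \<inter> K2"
    then obtain y1 y2 where
      "\<forall>i<m1. (\<Sum>j<N. A1 i j * z j) + (\<Sum>j<k1. B1 i j * y1 j) \<ge> 0"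
      "\<forall>i<m2. (\<Sum>j<N. A2 i j * z j) + (\<Sum>j<k2. B2 i j * y2 j) \<ge> 0" unfolding K1 K2 by blast
    then have "S z (\<lambda>j. if j < k1 then y1 j else y2 (j - k1))" unfolding S by simp
    then show "z \<in> {z. \<exists>y. S z y}" by blast
  next
    fix z assume "z \<in> {z. \<exists>y. S z y}"
    then show "z \<in> K1 \<inter> K2" unfolding S K1 K2 by auto
  qed
  then show ?thesis unfolding proj_cone_def S_def by blast
qed

text \<open>The first \<open>N\<close> auxiliary variables hold the summand \<open>u\<close> from
  \<open>K1\<close>; the system of \<open>K2\<close> is then imposed on \<open>z - u\<close>. The
  auxiliary variables of both systems follow.\<close>

lemma proj_cone_mink_sum:
  assumes "proj_cone N K1 m1" and "proj_cone N K2 m2"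
  shows "proj_cone N (mink_sum K1 K2) (m1 + m2)"
proof -
  from assms(1) obtain k1 :: nat and A1 B1 where K1: "K1 = {z. \<exists>y. \<forall>i<m1.
     (\<Sum>j<N. A1 i j * z j) + (\<Sum>j<k1. B1 i j * y j) \<ge> (0::real)}" unfolding proj_cone_def by blast
  from assms(2) obtain k2 :: nat and A2 B2 where K2: "K2 = {z. \<exists>y. \<forall>i<m2.
     (\<Sum>j<N. A2 i j * z j) + (\<Sum>j<k2. B2 i j * y j) \<ge> (0::real)}" unfolding proj_cone_def by blast
  define A where "A = (\<lambda>i j. if i < m1 then 0 else A2 (i - m1) j)"
  define B where "B = (\<lambda>i j.
     if i < m1 then (if j < N then A1 i j else if j < N + k1 then B1 i (j - N) else 0)
     else (if j < N then - A2 (i - m1) j else if j < N + k1 then 0 else B2 (i - m1) (j - (N + k1))))"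
  define S where "S = (\<lambda>z y. \<forall>i<m1 + m2.
     (\<Sum>j<N. A i j * z j) + (\<Sum>j<N + k1 + k2. B i j * y j) \<ge> (0::real))"
  have S: "S z y \<longleftrightarrow>
     (\<forall>i<m1. (\<Sum>j<N. A1 i j * y j) + (\<Sum>j<k1. B1 i j * y (N + j)) \<ge> 0) \<and>
     (\<forall>i<m2. (\<Sum>j<N. A2 i j * (z j - y j)) + (\<Sum>j<k2. B2 i j * y (N + k1 + j)) \<ge> 0)" for z y
    by (simp add: S_def all_less_add_iff sum_lessThan_add A_def B_def right_diff_distrib
        sum_subtractf sum_negf add_diff_eq diff_add_eq)
  have "mink_sum K1 K2 = {z. \<exists>y. S z y}"
  proof (intro equalityI subsetI)
    fix z assume "z \<in> mink_sum K1 K2"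
    then obtain u y1 y2 where
      "\<forall>i<m1. (\<Sum>j<N. A1 i j * u j) + (\<Sum>j<k1. B1 i j * y1 j) \<ge> 0"
      "\<forall>i<m2. (\<Sum>j<N. A2 i j * (z j - u j)) + (\<Sum>j<k2. B2 i j * y2 j) \<ge> 0"
      unfolding K1 K2 mink_sum_def by blast
    then have "S z (\<lambda>j. if j < N then u j else if j < N + k1 then y1 (j - N) else y2 (j - (N + k1)))"
      unfolding S by simp
    then show "z \<in> {z. \<exists>y. S z y}" by blast
  next
    fix z assume "z \<in> {z. \<exists>y. S z y}"
    then obtain y where y: "S z y" by blast
    \<comment> \<open>All of \<open>y\<close> can serve as the summand, because \<open>K1\<close>
      and \<open>K2\<close> only look at the first \<open>N\<close> coordinates.\<close>
    have "y \<in> K1" using y unfolding S K1 by (auto intro!: exI[of _ "\<lambda>j. y (N + j)"])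
    moreover have "(\<lambda>j. z j - y j) \<in> K2"
      using y unfolding S K2 by (auto intro!: exI[of _ "\<lambda>j. y (N + k1 + j)"])
    ultimately show "z \<in> mink_sum K1 K2" unfolding mink_sum_def by blast
  qed
  then show ?thesis unfolding proj_cone_def S_def by blast
qed

section \<open>Finite disjunctions and conjunctions, and layered reachability\<close>

primrec mink_sum_upto :: "(nat \<Rightarrow> (nat \<Rightarrow> real) set) \<Rightarrow> nat \<Rightarrow> (nat \<Rightarrow> real) set" where
  "mink_sum_upto K 0 = K 0"
| "mink_sum_upto K (Suc q) = mink_sum (mink_sum_upto K q) (K (Suc q))"

lemma proj_cone_mink_sum_upto:
  assumes "\<And>b. b \<le> q \<Longrightarrow> proj_cone N (K b) m"
  shows "proj_cone N (mink_sum_upto K q) (Suc q * m)"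
  using assms
proof (induction q)
  case (Suc q)
  have "proj_cone N (mink_sum_upto K (Suc q)) (Suc q * m + m)"
    unfolding mink_sum_upto.simps using Suc by (intro proj_cone_mink_sum) auto
  then show ?case by (simp add: add.commute)
qed simp

lemma mink_sum_upto_superset:
  assumes "\<And>b. b \<le> q \<Longrightarrow> (\<lambda>_. 0) \<in> K b" and "b \<le> q"
  shows "K b \<subseteq> mink_sum_upto K q"
  using assms
proof (induction q arbitrary: b)
  case (Suc q)
  have zero: "(\<lambda>_. 0) \<in> mink_sum_upto K q"
    using Suc.IH[of 0] Suc.prems(1) by auto
  show ?case
  proof (cases "b = Suc q")
    case True
    then show ?thesis using zero by (force simp: mink_sum_def)
  next
    case False
    then have "K b \<subseteq> mink_sum_upto K q" using Suc by auto
    then show ?thesis using Suc.prems(1)[of "Suc q"] by (force simp: mink_sum_def)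
  qed
qed simp

text \<open>Soundness of a disjunction: a condition closed under addition, such as a homogeneous
  linear inequality, passes from all alternatives to their sum.\<close>

lemma mink_sum_upto_subset:
  assumes "\<And>b. b \<le> q \<Longrightarrow> K b \<subseteq> V" and "\<And>u v. u \<in> V \<Longrightarrow> v \<in> V \<Longrightarrow> (\<lambda>j. u j + v j) \<in> V"
  shows "mink_sum_upto K q \<subseteq> V"
  using assms(1)
proof (induction q)
  case (Suc q)
  show ?case
  proof
    fix z assume "z \<in> mink_sum_upto K (Suc q)"
    then obtain u where "u \<in> mink_sum_upto K q" "(\<lambda>j. z j - u j) \<in> K (Suc q)"
      by (auto simp: mink_sum_def)
    moreover have "mink_sum_upto K q \<subseteq> V" using Suc by simp
    ultimately have "u \<in> V" "(\<lambda>j. z j - u j) \<in> V" using Suc.prems[of "Suc q"] by auto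
    from assms(2)[OF this] show "z \<in> V" by simp
  qed
qed simp

lemma proj_cone_Inter_upto:
  assumes "\<And>b. b \<le> q \<Longrightarrow> proj_cone N (K b) m"
  shows "proj_cone N (\<Inter>b\<le>q. K b) (Suc q * m)"
  using assms
proof (induction q)
  case (Suc q)
  have "proj_cone N ((\<Inter>b\<le>q. K b) \<inter> K (Suc q)) (Suc q * m + m)"
    using Suc by (intro proj_cone_Int) auto
  moreover have "(\<Inter>b\<le>q. K b) \<inter> K (Suc q) = (\<Inter>b\<le>Suc q. K b)" by (auto simp: le_Suc_eq)
  ultimately show ?case by (simp add: add.commute)
qed simp

text \<open>\<open>E i a c\<close> is the cone of the edge from state \<open>a\<close> at level \<open>i + 1\<close> to state \<open>c\<close> at level \<open>i\<close>;
  \<open>reach_cone E q r i a c\<close> descends from level \<open>i + 2^r\<close> to level \<open>i\<close> through states \<open>{..q}\<close>.\<close>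

primrec reach_cone ::
  "(nat \<Rightarrow> nat \<Rightarrow> nat \<Rightarrow> (nat \<Rightarrow> real) set) \<Rightarrow> nat \<Rightarrow> nat \<Rightarrow> nat \<Rightarrow> nat \<Rightarrow> nat \<Rightarrow> (nat \<Rightarrow> real) set" where
  "reach_cone E q 0 i a c = E i a c"
| "reach_cone E q (Suc r) i a c =
     mink_sum_upto (\<lambda>b. reach_cone E q r (i + 2 ^ r) a b \<inter> reach_cone E q r i b c) q"

text \<open>Each bisection sums over \<open>Suc q\<close> midpoints and intersects two halves, which
  multiplies the size by \<open>2 * Suc q\<close>.\<close>

lemma proj_cone_reach_cone:
  assumes "\<And>i a c. proj_cone N (E i a c) m"
  shows "proj_cone N (reach_cone E q r i a c) ((2 * Suc q) ^ r * m)"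
proof (induction r arbitrary: i a c)
  case 0
  then show ?case using assms by simp
next
  case (Suc r)
  have "proj_cone N (reach_cone E q (Suc r) i a c)
          (Suc q * ((2 * Suc q) ^ r * m + (2 * Suc q) ^ r * m))"
    unfolding reach_cone.simps by (intro proj_cone_mink_sum_upto proj_cone_Int Suc)
  moreover have "Suc q * ((2 * Suc q) ^ r * m + (2 * Suc q) ^ r * m) = (2 * Suc q) ^ Suc r * m"
    by (simp add: mult_2 distrib_left distrib_right mult.assoc)
  ultimately show ?case by metis
qed

text \<open>Completeness: a point satisfying every edge of one walk \<open>e\<close> is in both
  halves at the midpoint \<open>e (i + 2 ^ r)\<close>, and the other summands can be taken as
  0.\<close>

lemma reach_cone_walk:
  assumes "\<And>i a c. proj_cone N (E i a c) m" and "\<And>j. e j \<le> q"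
    and "\<And>j. i \<le> j \<Longrightarrow> j < i + 2 ^ r \<Longrightarrow> z \<in> E j (e (Suc j)) (e j)"
  shows "z \<in> reach_cone E q r i (e (i + 2 ^ r)) (e i)"
  using assms(3)
proof (induction r arbitrary: i)
  case 0
  then show ?case by simp
next
  case (Suc r)
  let ?R = "\<lambda>b. reach_cone E q r (i + 2 ^ r) (e (i + 2 ^ Suc r)) b \<inter> reach_cone E q r i b (e i)"
  have "z \<in> reach_cone E q r (i + 2 ^ r) (e (i + 2 ^ r + 2 ^ r)) (e (i + 2 ^ r))"
    using Suc.prems by (intro Suc.IH) auto
  then have "z \<in> reach_cone E q r (i + 2 ^ r) (e (i + 2 ^ Suc r)) (e (i + 2 ^ r))"
    by (simp add: mult_2 add.assoc)
  moreover have "z \<in> reach_cone E q r i (e (i + 2 ^ r)) (e i)"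
    using Suc.prems by (intro Suc.IH) auto
  ultimately have "z \<in> ?R (e (i + 2 ^ r))" by blast
  moreover have "(\<lambda>_. 0) \<in> reach_cone E q r i a c" for i a c
    using proj_cone_reach_cone[of N E m, OF assms(1)] by (rule proj_cone_zero)
  then have "?R (e (i + 2 ^ r)) \<subseteq> mink_sum_upto ?R q"
    using assms(2) by (intro mink_sum_upto_superset) auto
  ultimately show ?case by auto
qed

text \<open>Soundness: if the top state is true and the bottom state false, then whatever the
  midpoint is, one of the two halves again leads from true to false. Its cone, and hence the
  intersection, lies in \<open>V\<close>.\<close>

lemma reach_cone_separation:
  assumes add: "\<And>u v. u \<in> V \<Longrightarrow> v \<in> V \<Longrightarrow> (\<lambda>j. u j + v j) \<in> V"
    and E: "\<And>i a c. sat (Suc i) a \<Longrightarrow> \<not> sat i c \<Longrightarrow> E i a c \<subseteq> V"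
    and "sat (i + 2 ^ r) a" and "\<not> sat i c"
  shows "reach_cone E q r i a c \<subseteq> V"
  using assms(3,4)
proof (induction r arbitrary: i a c)
  case 0
  then show ?case using E by simp
next
  case (Suc r)
  show ?case unfolding reach_cone.simps
  proof (rule mink_sum_upto_subset[OF _ add])
    fix b
    show "reach_cone E q r (i + 2 ^ r) a b \<inter> reach_cone E q r i b c \<subseteq> V"
    proof (cases "sat (i + 2 ^ r) b")
      case True
      then show ?thesis using Suc.IH Suc.prems(2) by blast
    next
      case False
      then show ?thesis using Suc.IH[of "i + 2 ^ r" a b] Suc.prems(1) 
        by (simp add: mult_2 add.assoc le_infI1)
    qed
  qed auto
qed

subsection \<open>Weighted thresholds\<close>

text \<open>Homogenisation of the box \<open>[0, 1]^n\<close> cut by one knapsack inequality, with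
  coordinate \<open>n\<close> in the role of the constant 1.\<close>

definition knap_cone :: "nat \<Rightarrow> (nat \<Rightarrow> real) \<Rightarrow> real \<Rightarrow> (nat \<Rightarrow> real) set" where
  "knap_cone n a \<mu> = {z. (\<forall>j<n. 0 \<le> z j \<and> z j \<le> z n) \<and> (\<Sum>j<n. a j * z j) \<ge> \<mu> * z n}"

definition hom_indicator :: "nat \<Rightarrow> nat set \<Rightarrow> nat \<Rightarrow> real" where
  "hom_indicator n A j = of_bool (j = n \<or> j \<in> A)"

lemma hom_indicator_last [simp]: "hom_indicator n A n = 1"
  by (simp add: hom_indicator_def)

lemma sum_mult_of_bool_subset:
  fixes f :: "nat \<Rightarrow> 'a::semiring_1"
  assumes "A \<subseteq> {..<n}"
  shows "(\<Sum>j<n. f j * of_bool (j = n \<or> j \<in> A)) = sum f A"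
proof -
  have "(\<Sum>j<n. f j * of_bool (j = n \<or> j \<in> A)) = (\<Sum>j<n. if j \<in> A then f j else 0)"
    by (intro sum.cong) auto
  also have "\<dots> = sum f A" using assms by (simp add: sum.inter_restrict[symmetric] inf.absorb2)
  finally show ?thesis .
qed

lemma sum_mult_hom_indicator:
  "A \<subseteq> {..<n} \<Longrightarrow> (\<Sum>j<n. a j * hom_indicator n A j) = sum a A"
  unfolding hom_indicator_def by (rule sum_mult_of_bool_subset)

lemma hom_indicator_in_knap_cone:
  assumes "A \<subseteq> {..<n}" and "\<mu> \<le> sum a A"
  shows "hom_indicator n A \<in> knap_cone n a \<mu>"
  using assms by (auto simp: knap_cone_def sum_mult_hom_indicator) (auto simp: hom_indicator_def)

lemma proj_cone_knap_cone: "proj_cone (Suc n) (knap_cone n a \<mu>) (2 * n + 1)"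
proof -
  \<comment> \<open>Rows \<open>i < n\<close> express \<open>0 \<le> z i\<close>, rows
    \<open>n + i\<close> express \<open>z i \<le> z n\<close>, and row \<open>2 * n\<close> is the
    knapsack inequality.\<close>
  define A :: "nat \<Rightarrow> nat \<Rightarrow> real" where
    "A = (\<lambda>i j. if i < n then of_bool (j = i)
           else if i < 2 * n then of_bool (j = n) - of_bool (n + j = i)
           else if j < n then a j else - \<mu>)"
  have 1: "(\<Sum>j<Suc n. A i j * z j) = z i" if "i < n" for i z
    using that by (simp add: A_def)
  have 2: "(\<Sum>j<Suc n. A (n + i) j * z j) = z n - z i" if "i < n" for i z
    using that by (simp add: A_def left_diff_distrib sum_subtractf)
  have 3: "(\<Sum>j<Suc n. A (n + n) j * z j) = (\<Sum>j<n. a j * z j) - \<mu> * z n" for z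
    by (simp add: A_def)
  have "knap_cone n a \<mu> = {z. \<forall>i<n + n + 1. (\<Sum>j<Suc n. A i j * z j) \<ge> 0}"
    unfolding knap_cone_def by (simp only: all_less_add_iff) (auto simp: 1 2 3 simp del: sum.lessThan_Suc)
  then show ?thesis using proj_cone_halfspaces[of "Suc n" "n + n + 1" A] by (simp add: mult_2)
qed

text \<open>An item \<open>j\<close> of \<open>A\<close> contributes at most
  \<open>a j * z n\<close>; the rest of the demand must come from outside \<open>A\<close>.\<close>

lemma knap_cone_residual:
  assumes z: "z \<in> knap_cone n a \<mu>" and A: "A \<subseteq> {..<n}" and a: "\<And>j. j \<in> A \<Longrightarrow> a j \<ge> 0"
  shows "(\<mu> - sum a A) * z n \<le> (\<Sum>j\<in>{..<n} - A. a j * z j)"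
proof -
  have "(\<Sum>j\<in>A. a j * z j) \<le> (\<Sum>j\<in>A. a j * z n)"
    using assms by (intro sum_mono mult_left_mono) (auto simp: knap_cone_def)
  moreover have "(\<Sum>j<n. a j * z j) = (\<Sum>j\<in>{..<n} - A. a j * z j) + (\<Sum>j\<in>A. a j * z j)"
    using A by (intro sum.subset_diff) auto
  ultimately show ?thesis using z by (simp add: knap_cone_def left_diff_distrib sum_distrib_right)
qed

section \<open>Scanning the bits of integer weights\<close>

lemma sum_div_le:
  fixes f :: "'a \<Rightarrow> nat"
  assumes "finite A" "d > 0"
  shows "sum f A div d \<le> (\<Sum>i\<in>A. f i div d) + card A"
proof -
  have "sum f A = (\<Sum>i\<in>A. d * (f i div d) + f i mod d)" by simp
  also have "\<dots> \<le> (\<Sum>i\<in>A. d * (f i div d) + d)"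
    using assms by (intro sum_mono add_left_mono) (simp add: less_imp_le)
  also have "\<dots> = d * ((\<Sum>i\<in>A. f i div d) + card A)"
    by (simp add: sum.distrib sum_distrib_left distrib_left)
  finally have "sum f A div d \<le> d * ((\<Sum>i\<in>A. f i div d) + card A) div d" by (rule div_le_mono)
  then show ?thesis using assms(2) by simp
qed

lemma div_power2_Suc: "(a::nat) div 2 ^ k = 2 * (a div 2 ^ Suc k) + a div 2 ^ k mod 2"
  by (simp add: div_mult2_eq mult.commute[of 2 "2 ^ k"])

text \<open>State \<open>c\<close> at level \<open>k\<close> asserts that \<open>\<Sum>\<lfloor>W\<^sub>i / 2^k\<rfloor> x\<^sub>i \<ge> \<lfloor>t / 2^k\<rfloor> - (c - 1)\<close>. The deficit \<open>c - 1\<close> need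
  only range over \<open>{-1..n}\<close>: rounding down the weights loses at most \<open>n\<close>, and a surplus of \<open>1\<close> survives
  all lower bits. The right-hand side of an edge is what makes the two assertions match up.\<close>

definition bit_edge :: "nat \<Rightarrow> (nat \<Rightarrow> nat) \<Rightarrow> nat \<Rightarrow> nat \<Rightarrow> nat \<Rightarrow> nat \<Rightarrow> (nat \<Rightarrow> real) set" where
  "bit_edge n W t k a c = knap_cone n (\<lambda>i. real (W i div 2 ^ k mod 2))
     (real (t div 2 ^ k mod 2) + 2 * real a - real c - 1)"

definition bit_sat :: "nat set \<Rightarrow> (nat \<Rightarrow> nat) \<Rightarrow> nat \<Rightarrow> nat \<Rightarrow> nat \<Rightarrow> bool" where
  "bit_sat A W t k c \<longleftrightarrow> t div 2 ^ k < (\<Sum>i\<in>A. W i div 2 ^ k) + c"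

lemma sum_div_power2_Suc:
  fixes W :: "'a \<Rightarrow> nat"
  shows "(\<Sum>i\<in>A. W i div 2 ^ k) = 2 * (\<Sum>i\<in>A. W i div 2 ^ Suc k) + (\<Sum>i\<in>A. W i div 2 ^ k mod 2)"
  by (subst div_power2_Suc) (simp only: sum.distrib sum_distrib_left)

text \<open>By integrality, a true state above and a false state below force the bits of
  \<open>A\<close> to miss the right-hand side of the edge by at least 1. The residual inequality,
  whose weights are at most 1, then gives the claim.\<close>

lemma bit_edge_separation:
  assumes A: "A \<subseteq> {..<n}" and "bit_sat A W t (Suc k) a" and "\<not> bit_sat A W t k c"
  shows "bit_edge n W t k a c \<subseteq> {z. z n \<le> (\<Sum>i\<in>{..<n} - A. z i)}"
proof
  fix z assume z: "z \<in> bit_edge n W t k a c"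
  let ?b = "\<lambda>i. real (W i div 2 ^ k mod 2)"
  let ?\<mu> = "real (t div 2 ^ k mod 2) + 2 * real a - real c - 1"
  let ?N = "\<Sum>i\<in>A. W i div 2 ^ k mod 2" and ?S = "\<Sum>i\<in>A. W i div 2 ^ Suc k"
  have "t div 2 ^ Suc k < ?S + a" using assms(2) unfolding bit_sat_def .
  moreover have "2 * ?S + ?N + c \<le> 2 * (t div 2 ^ Suc k) + t div 2 ^ k mod 2"
    using assms(3) unfolding bit_sat_def by (metis not_less sum_div_power2_Suc div_power2_Suc)
  ultimately have "?N + c + 2 \<le> 2 * a + t div 2 ^ k mod 2" by linarith
  then have "real ?N + 1 \<le> ?\<mu>" by linarith
  then have N: "1 \<le> ?\<mu> - sum ?b A" by simp
  show "z \<in> {z. z n \<le> (\<Sum>i\<in>{..<n} - A. z i)}"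
  \<comment> \<open>Without items the box does not force \<open>z n \<ge> 0\<close>, so the sign of
    \<open>z n\<close> is read off the knapsack inequality instead.\<close>
  proof (cases "n = 0")
    case True
    have "z \<in> knap_cone n ?b ?\<mu>" using z by (simp add: bit_edge_def)
    then have "?\<mu> * z n \<le> 0" using True by (simp add: knap_cone_def)
    moreover have "?\<mu> > 0" using N True A by simp
    ultimately have "z n \<le> 0" by (metis mult_pos_pos not_less)
    then show ?thesis using True by simp
  next
    case False
    have z0: "0 \<le> z j" "z j \<le> z n" if "j < n" for j using z that by (auto simp: bit_edge_def knap_cone_def)
    have "z n \<ge> 0" using z0[of 0] False by simp
    then have "z n \<le> (?\<mu> - sum ?b A) * z n" using mult_right_mono[OF N] by simp
    also have "\<dots> \<le> (\<Sum>j\<in>{..<n} - A. ?b j * z j)"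
      using z A unfolding bit_edge_def by (intro knap_cone_residual) auto
    also have "\<dots> \<le> (\<Sum>j\<in>{..<n} - A. 1 * z j)"
      using z0 by (intro sum_mono mult_right_mono) (auto simp: le_less_Suc_eq[symmetric] less_Suc_eq_le)
    finally show ?thesis by simp
  qed
qed

text \<open>State 1 is used at both ends. At level \<open>2 ^ r\<close> all quotients vanish and it
  is trivially true; at level 0 it is the threshold itself. In between there are
  \<open>n + 2\<close> states and \<open>r\<close> rounds of bisection.\<close>

lemma integer_threshold_cone:
  fixes W :: "nat \<Rightarrow> nat"
  assumes W: "\<And>i. i < n \<Longrightarrow> W i < 2 ^ 2 ^ r" and t: "t < 2 ^ 2 ^ r"
  obtains K where "proj_cone (Suc n) K ((2 * (n + 2)) ^ r * (2 * n + 1))"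
    and "\<And>A. A \<subseteq> {..<n} \<Longrightarrow> t \<le> sum W A \<Longrightarrow> hom_indicator n A \<in> K"
    and "\<And>A. A \<subseteq> {..<n} \<Longrightarrow> sum W A < t \<Longrightarrow> K \<subseteq> {z. z n \<le> (\<Sum>i\<in>{..<n} - A. z i)}"
proof
  let ?E = "bit_edge n W t"
  let ?K = "reach_cone ?E (Suc n) r 0 1 1"
  have E: "proj_cone (Suc n) (?E k a c) (2 * n + 1)" for k a c
    unfolding bit_edge_def by (rule proj_cone_knap_cone)
  show "proj_cone (Suc n) ?K ((2 * (n + 2)) ^ r * (2 * n + 1))"
    using proj_cone_reach_cone[of "Suc n" ?E "2 * n + 1" "Suc n" r, OF E] by simp
  show "hom_indicator n A \<in> ?K" if A: "A \<subseteq> {..<n}" "t \<le> sum W A" for A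
  proof -
    have fin: "finite A" and cA: "card A \<le> n"
      using A(1) finite_subset[of A "{..<n}"] card_mono[of "{..<n}" A] by auto
    define S where "S = (\<lambda>k. \<Sum>i\<in>A. W i div 2 ^ k)"
    \<comment> \<open>The walk of a set meeting the threshold: the least true state at each level,
      except that level 0 must end in state 1. Truncated subtraction turns every surplus into state
      0.\<close>
    define e where "e = (\<lambda>k. if k = 0 then 1 else Suc (t div 2 ^ k) - S k)"
    have eS: "Suc (t div 2 ^ k) \<le> e k + S k" for k
      using A(2) unfolding e_def S_def by (cases "k = 0") auto
    have top: "e (2 ^ r) = 1"
    proof -
      have "S (2 ^ r) = 0" unfolding S_def using W A(1) by (auto intro!: sum.neutral)
      then show ?thesis using t by (simp add: e_def)
    qed
    \<comment> \<open>Rounding down loses at most one unit per item of \<open>A\<close>, so the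
      deficit never exceeds \<open>n\<close>.\<close>
    have "e k \<le> Suc n" for k
    proof -
      have "t div 2 ^ k \<le> sum W A div 2 ^ k" using A(2) by (rule div_le_mono)
      also have "\<dots> \<le> S k + card A" unfolding S_def using fin by (intro sum_div_le) auto
      finally show ?thesis using cA by (auto simp: e_def)
    qed
    moreover have "hom_indicator n A \<in> ?E k (e (Suc k)) (e k)" for k
      unfolding bit_edge_def
    proof (rule hom_indicator_in_knap_cone[OF A(1)])
      let ?N = "\<Sum>i\<in>A. W i div 2 ^ k mod 2"
      have "S k = 2 * S (Suc k) + ?N" unfolding S_def by (rule sum_div_power2_Suc)
      moreover have "t div 2 ^ k = 2 * (t div 2 ^ Suc k) + t div 2 ^ k mod 2" by (rule div_power2_Suc)
      moreover have "e (Suc k) = Suc (t div 2 ^ Suc k) - S (Suc k)" by (simp add: e_def)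
      \<comment> \<open>This settles the case \<open>e (Suc k) = 0\<close>, where the subtraction is
        truncated and the other equations say too little.\<close>
      moreover have "t div 2 ^ k mod 2 \<le> 1" by simp
      ultimately have "t div 2 ^ k mod 2 + 2 * e (Suc k) \<le> ?N + e k + 1"
        using eS[of k] by linarith
      then show "real (t div 2 ^ k mod 2) + 2 * real (e (Suc k)) - real (e k) - 1
          \<le> (\<Sum>i\<in>A. real (W i div 2 ^ k mod 2))"
        by (simp flip: of_nat_sum)
    qed
    ultimately have "hom_indicator n A \<in> reach_cone ?E (Suc n) r 0 (e (0 + 2 ^ r)) (e 0)"
      by (intro reach_cone_walk[where m = "2 * n + 1" and N = "Suc n"] E)
    moreover have "e 0 = 1" by (simp add: e_def)
    ultimately show ?thesis using top by simp
  qed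
  show "?K \<subseteq> {z. z n \<le> (\<Sum>i\<in>{..<n} - A. z i)}" if A: "A \<subseteq> {..<n}" "sum W A < t" for A
  proof (rule reach_cone_separation[where sat = "bit_sat A W t"])
    show "bit_sat A W t (0 + 2 ^ r) 1" using t by (simp add: bit_sat_def)
    show "\<not> bit_sat A W t 0 1" using A(2) by (simp add: bit_sat_def)
  qed (use bit_edge_separation[OF A(1)] in \<open>auto simp: sum.distrib\<close>)
qed

text \<open>With \<open>- T\<close> as an additional weight, the threshold becomes the sign of one
  linear form at 0/1 vectors of length \<open>n + 1\<close>. Integer weights preserving these signs
  therefore define the same threshold.\<close>

lemma threshold_cone:
  fixes w :: "nat \<Rightarrow> real"
  assumes w: "\<And>i. i < n \<Longrightarrow> w i \<ge> 0" and l: "n + 1 \<le> 2 ^ l"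
  obtains K where "proj_cone (Suc n) K ((2 * (n + 2)) ^ (3 * l) * (2 * n + 1))"
    and "\<And>A. A \<subseteq> {..<n} \<Longrightarrow> T \<le> sum w A \<Longrightarrow> hom_indicator n A \<in> K"
    and "\<And>A. A \<subseteq> {..<n} \<Longrightarrow> sum w A < T \<Longrightarrow> K \<subseteq> {z. z n \<le> (\<Sum>i\<in>{..<n} - A. z i)}"
proof -
  define v where "v = (\<lambda>i. if i < n then w i else - T)"
  have "card {i. i < Suc n \<and> v i \<noteq> 0} \<le> card {..<Suc n}" by (intro card_mono) auto
  then have "card {i. i < Suc n \<and> v i \<noteq> 0} \<le> n + 1" by simp
  from sign_preserving_integer_weights[of "n + 1", OF _ this]
  obtain V :: "nat \<Rightarrow> int" where
    Vb: "\<And>i. i < Suc n \<Longrightarrow> \<bar>V i\<bar> < int (((n + 1) ^ Suc (Suc n) + 1) ^ (n + 1))" and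
    Vs: "\<And>x::nat \<Rightarrow> int. (\<Sum>i<Suc n. \<bar>x i\<bar>) \<le> int (n + 1) \<Longrightarrow>
       real_of_int (sgn (\<Sum>i<Suc n. V i * x i)) = sgn (\<Sum>i<Suc n. v i * real_of_int (x i))"
    by auto
  \<comment> \<open>The base is at most \<open>2 ^ 2 ^ (2 * l)\<close>, and the power
    \<open>n + 1 \<le> 2 ^ l\<close> adds another \<open>l\<close> to the upper exponent.\<close>
  have bound: "((n + 1) ^ Suc (Suc n) + 1) ^ (n + 1) \<le> (2::nat) ^ 2 ^ (3 * l)"
  proof -
    have "(n + 1) ^ Suc (Suc n) + 1 \<le> (2 ^ l) ^ Suc (Suc n) + (1::nat)"
      using l by (intro add_mono power_mono) auto
    also have "\<dots> = 2 ^ (l * (n + 2)) + 1" by (simp only: power_mult add_2_eq_Suc')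
    also have "\<dots> \<le> (2::nat) ^ (l * (n + 2) + 1)" by simp
    also have "l * (n + 2) + 1 \<le> 2 ^ l * 2 ^ l"
    proof -
      \<comment> \<open>For \<open>x = 2 ^ l - 1\<close> both \<open>l \<le> x\<close> and
        \<open>n + 2 \<le> x + 2\<close> hold, and \<open>x * (x + 2) + 1\<close> is the square of
        \<open>2 ^ l\<close>.\<close>
      have "l + 1 \<le> 2 ^ l" using less_exp[of l] by linarith
      moreover from this obtain x where x: "(2::nat) ^ l = Suc x" by (cases "(2::nat) ^ l") auto
      ultimately have "l * (n + 2) \<le> x * (x + 2)" using l by (intro mult_mono) auto
      then show ?thesis by (simp add: x)
    qed
    then have "(2::nat) ^ (l * (n + 2) + 1) \<le> 2 ^ (2 ^ l * 2 ^ l)" by (intro power_increasing) auto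
    finally have "((n + 1) ^ Suc (Suc n) + 1) ^ (n + 1) \<le> ((2::nat) ^ (2 ^ l * 2 ^ l)) ^ (n + 1)"
      by (intro power_mono) auto
    also have "\<dots> \<le> (2 ^ (2 ^ l * 2 ^ l)) ^ 2 ^ l" using l by (intro power_increasing) auto
    also have "\<dots> = 2 ^ 2 ^ (3 * l)"
      by (simp add: power_mult[symmetric] power_add[symmetric] numeral_3_eq_3)
    finally show ?thesis .
  qed
  define W where "W = (\<lambda>i. nat (V i))"
  \<comment> \<open>If \<open>V n\<close> is positive, \<open>nat\<close> yields the threshold 0.
    This agrees with the original one, which every set then meets because the \<open>V i\<close>
    with \<open>i < n\<close> are nonnegative.\<close>
  define t where "t = nat (- V n)"
  have V0: "V i \<ge> 0" if "i < n" for i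
  proof -
    \<comment> \<open>Evaluating the sign at a unit vector.\<close>
    have "real_of_int (sgn (V i)) = sgn (v i)"
      using Vs[of "\<lambda>j. of_bool (j = i)"] that by simp
    moreover have "sgn (v i) \<ge> 0" using w[OF that] that by (simp add: v_def)
    ultimately have "sgn (V i) \<ge> 0" by linarith
    then show ?thesis by (simp add: sgn_if split: if_splits)
  qed
  have iff: "t \<le> sum W A \<longleftrightarrow> T \<le> sum w A" if A: "A \<subseteq> {..<n}" for A
  proof -
    define x :: "nat \<Rightarrow> int" where "x = (\<lambda>j. of_bool (j = n \<or> j \<in> A))"
    have sumx: "(\<Sum>j<n. f j * x j) = sum f A" for f :: "nat \<Rightarrow> int"
      unfolding x_def using A by (rule sum_mult_of_bool_subset)
    have sumx': "(\<Sum>j<n. f j * real_of_int (x j)) = sum f A" for f :: "nat \<Rightarrow> real"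
      unfolding x_def of_int_of_bool using A by (rule sum_mult_of_bool_subset)
    have xn: "x n = 1" by (simp add: x_def)
    have "(\<Sum>j<Suc n. \<bar>x j\<bar>) \<le> (\<Sum>j<Suc n. 1)" by (intro sum_mono) (simp add: x_def)
    then have "(\<Sum>j<Suc n. \<bar>x j\<bar>) \<le> int (n + 1)" by simp
    from Vs[OF this] have "real_of_int (sgn (sum V A + V n)) = sgn (sum v A + v n)"
      by (simp add: sumx sumx' xn)
    also have "sum v A = sum w A" using A by (intro sum.cong) (auto simp: v_def)
    also have "v n = - T" by (simp add: v_def)
    finally have "0 \<le> sum V A + V n \<longleftrightarrow> 0 \<le> sum w A - T"
      by (auto simp: sgn_if split: if_splits)
    moreover have "int (sum W A) = sum V A"
      using V0 A by (simp add: W_def) (intro sum.cong, auto)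
    moreover have "sum V A \<ge> 0" using V0 A by (intro sum_nonneg) auto
    ultimately show ?thesis unfolding t_def by linarith
  qed
  have W: "W i < 2 ^ 2 ^ (3 * l)" if "i < n" for i
  proof -
    have "W i < ((n + 1) ^ Suc (Suc n) + 1) ^ (n + 1)"
      using Vb[of i] that unfolding W_def by linarith
    then show ?thesis using bound by linarith
  qed
  have t: "t < 2 ^ 2 ^ (3 * l)"
  proof -
    have "t < ((n + 1) ^ Suc (Suc n) + 1) ^ (n + 1)"
      using Vb[of n] unfolding t_def by linarith
    then show ?thesis using bound by linarith
  qed
  show ?thesis
  proof (rule integer_threshold_cone[OF W t])
    fix K assume "proj_cone (Suc n) K ((2 * (n + 2)) ^ (3 * l) * (2 * n + 1))"
      and "\<And>A. A \<subseteq> {..<n} \<Longrightarrow> t \<le> sum W A \<Longrightarrow> hom_indicator n A \<in> K"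
      and "\<And>A. A \<subseteq> {..<n} \<Longrightarrow> sum W A < t \<Longrightarrow> K \<subseteq> {z. z n \<le> (\<Sum>i\<in>{..<n} - A. z i)}"
    then show ?thesis using iff by (intro that[of K]) (simp_all add: not_le[symmetric])
  qed
qed

subsection \<open>Knapsack cover inequalities and rounding\<close>

text \<open>Shifting weight between two fractional coordinates towards the cheaper density leaves at most
  one fractional coordinate, and dropping that one loses at most \<open>U\<close>.\<close>

lemma knapsack_exchange_rounding:
  fixes p c z :: "'a \<Rightarrow> real"
  assumes "finite I" and "\<And>i. i \<in> I \<Longrightarrow> 0 \<le> p i" and "\<And>i. i \<in> I \<Longrightarrow> p i \<le> U"
    and "\<And>i. i \<in> I \<Longrightarrow> 0 \<le> c i" and "\<And>i. i \<in> I \<Longrightarrow> 0 \<le> z i \<and> z i \<le> 1"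
    and "(\<Sum>i\<in>I. p i * z i) \<ge> 2 * U" and U0: "0 \<le> U"
  shows "\<exists>F\<subseteq>I. sum p F \<ge> U \<and> sum c F \<le> (\<Sum>i\<in>I. c i * z i)"
  using assms(1-6)
proof (induction "card {i\<in>I. 0 < z i \<and> z i < 1}" arbitrary: z rule: less_induct)
  case less
  note fin = less.prems(1) and p0 = less.prems(2) and pU = less.prems(3) and c0 = less.prems(4)
    and z01 = less.prems(5) and zU = less.prems(6)
  let ?frac = "\<lambda>z. {i\<in>I. 0 < z i \<and> z i < 1}"
  show ?case
  proof (cases "\<exists>i j. i \<in> ?frac z \<and> j \<in> ?frac z \<and> i \<noteq> j")
    case True
    \<comment> \<open>Item \<open>i\<close> has the smaller cost per unit of \<open>p\<close>; the
      cross-multiplied form also covers zero sizes.\<close>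
    obtain i j where ij: "i \<in> ?frac z" "j \<in> ?frac z" "i \<noteq> j" and le: "c i * p j \<le> c j * p i"
    proof -
      from True obtain a b where ab: "a \<in> ?frac z" "b \<in> ?frac z" "a \<noteq> b" by blast
      show ?thesis
      proof (cases "c a * p b \<le> c b * p a")
        case True
        then show ?thesis using ab that by blast
      next
        case False
        then show ?thesis using ab that[of b a] by auto
      qed
    qed
    \<comment> \<open>The largest exchange that preserves the \<open>p\<close>-sum: raise
      \<open>z i\<close> by \<open>a\<close> and lower \<open>z j\<close> by \<open>b\<close> until
      \<open>z i\<close> reaches 1 or \<open>z j\<close> reaches 0. The case distinction asks which
      happens first.\<close>
    obtain a b where ab: "0 \<le> a" "0 \<le> b" "a \<le> 1 - z i" "b \<le> z j" "p i * a = p j * b"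
      "c i * a \<le> c j * b" "a = 1 - z i \<or> b = z j"
    proof (cases "p j * z j \<le> p i * (1 - z i)")
      case True
      show ?thesis
      proof (cases "p i = 0")
        case True
        then have "p j * z j \<le> 0" using \<open>p j * z j \<le> p i * (1 - z i)\<close> by simp
        then have "p j = 0" using ij p0[of j] by (auto simp: mult_le_0_iff)
        then show ?thesis using True ij c0[of j] by (intro that[of 0 "z j"]) auto
      next
        case False
        then have pi: "p i > 0" using p0[of i] ij by auto
        have "c i * (p j * z j / p i) \<le> c j * z j"
        proof -
          have "c i * p j * z j \<le> c j * p i * z j" using le ij by (intro mult_right_mono) auto
          then show ?thesis using pi by (simp add: field_simps)
        qed
        then show ?thesis using True pi ij p0[of j]
          by (intro that[of "p j * z j / p i" "z j"]) (auto simp: field_simps)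
      qed
    next
      case False
      then have pj: "p j > 0" using p0[of i] p0[of j] ij
        by (cases "p j = 0") auto
      have "c i * (1 - z i) \<le> c j * (p i * (1 - z i) / p j)"
      proof -
        have "c i * p j * (1 - z i) \<le> c j * p i * (1 - z i)" using le ij by (intro mult_right_mono) auto
        then show ?thesis using pj by (simp add: field_simps)
      qed
      then show ?thesis using False pj ij p0[of i]
        by (intro that[of "1 - z i" "p i * (1 - z i) / p j"]) (auto simp: field_simps mult_left_le)
    qed
    define z' where "z' = z(i := z i + a, j := z j - b)"
    have sum': "(\<Sum>k\<in>I. f k * z' k) = (\<Sum>k\<in>I. f k * z k) + f i * a - f j * b" for f :: "'a \<Rightarrow> real"
    proof -
      have "(\<Sum>k\<in>I. f k * z' k) = (\<Sum>k\<in>I. f k * z k + ((if k = i then f i * a else 0) - (if k = j then f j * b else 0)))"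
        using ij by (intro sum.cong) (auto simp: z'_def algebra_simps)
      also have "\<dots> = (\<Sum>k\<in>I. f k * z k) + (f i * a - f j * b)"
        using fin ij by (simp add: sum.distrib sum_subtractf)
      finally show ?thesis by simp
    qed
    have "?frac z' \<subset> ?frac z"
    proof -
      have "?frac z' \<subseteq> ?frac z" using ij by (auto simp: z'_def split: if_splits)
      moreover have "i \<notin> ?frac z' \<or> j \<notin> ?frac z'" using ab(7) ij(3) by (auto simp: z'_def)
      ultimately show ?thesis using ij by blast
    qed
    then have "card (?frac z') < card (?frac z)" using fin by (intro psubset_card_mono) auto
    moreover have "0 \<le> z' k \<and> z' k \<le> 1" if "k \<in> I" for k
      using z01[OF that] ab ij by (auto simp: z'_def)
    moreover have "(\<Sum>k\<in>I. p k * z' k) \<ge> 2 * U" using zU ab(5) by (simp add: sum')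
    ultimately obtain F where F: "F \<subseteq> I" "sum p F \<ge> U" "sum c F \<le> (\<Sum>k\<in>I. c k * z' k)"
      using less.hyps[of z'] fin p0 pU c0 by blast
    have "(\<Sum>k\<in>I. c k * z' k) \<le> (\<Sum>k\<in>I. c k * z k)" using ab(6) by (simp add: sum')
    then show ?thesis using F by (intro exI[of _ F]) auto
  next
    case False
    define F where "F = {i\<in>I. z i = 1}"
    have "(\<Sum>i\<in>?frac z. p i * z i) \<le> U"
    proof (cases "?frac z = {}")
      case True
      then show ?thesis using U0 by (simp only: sum.empty)
    next
      case nonempty: False
      then obtain k where k: "?frac z = {k}" using False by blast
      then have "k \<in> ?frac z" by blast
      then have "p k * z k \<le> p k * 1" using p0 by (intro mult_left_mono) auto
      then show ?thesis using k pU \<open>k \<in> ?frac z\<close> by fastforce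
    qed
    moreover have split: "(\<Sum>i\<in>I. f i * z i) = sum f F + (\<Sum>i\<in>?frac z. f i * z i)" for f :: "'a \<Rightarrow> real"
    proof -
      have "(\<Sum>i\<in>I. f i * z i) = (\<Sum>i\<in>F \<union> ?frac z. f i * z i)"
        using fin z01 by (intro sum.mono_neutral_right) (force simp: F_def)+
      also have "\<dots> = (\<Sum>i\<in>F. f i * z i) + (\<Sum>i\<in>?frac z. f i * z i)"
        using fin by (intro sum.union_disjoint) (auto simp: F_def)
      also have "(\<Sum>i\<in>F. f i * z i) = sum f F" by (intro sum.cong) (auto simp: F_def)
      finally show ?thesis .
    qed
    ultimately have "sum p F \<ge> U" using zU by simp
    moreover have "(\<Sum>i\<in>?frac z. c i * z i) \<ge> 0" using c0 by (intro sum_nonneg) auto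
    then have "sum c F \<le> (\<Sum>i\<in>I. c i * z i)" by (simp add: split)
    moreover have "F \<subseteq> I" by (auto simp: F_def)
    ultimately show ?thesis by blast
  qed
qed

text \<open>\<open>C \<tau>\<close> encodes the guess that the items of size at most \<theta> weigh
  between \<open>\<tau> * \<delta>\<close> and \<open>(\<tau> + 1) * \<delta>\<close>. For residual
  demand \<open>U\<close>, the large items of \<open>A\<close> either miss their threshold, so large
  items outside \<open>A\<close> are required, or meet it, so the small items must supply at least
  \<open>U - \<delta>\<close> outside \<open>A\<close>. The condition on \<open>q\<close> makes the
  guesses exhaustive.\<close>

lemma knapsack_level_cone:
  fixes s :: "nat \<Rightarrow> real"
  assumes s: "\<And>i. i < n \<Longrightarrow> s i > 0" and n: "n > 0" and l: "n + 1 \<le> 2 ^ l"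
    and \<eta>: "0 < \<eta>" and \<theta>: "\<theta> \<ge> 0" and q: "real n \<le> \<eta> * real q"
  obtains K where
    "proj_cone (Suc n) K (Suc q * ((2 * n + 1) * ((2 * (n + 2)) ^ (3 * l) + 1)))"
    and "\<And>B. B \<subseteq> {..<n} \<Longrightarrow> D \<le> sum s B \<Longrightarrow> hom_indicator n B \<in> K"
    and "\<And>A z U. A \<subseteq> {..<n} \<Longrightarrow> sum s A = D - U \<Longrightarrow> U > 0 \<Longrightarrow> \<theta> \<le> U \<Longrightarrow>
           (\<And>i. i < n \<Longrightarrow> s i \<le> U \<Longrightarrow> s i \<le> \<theta>) \<Longrightarrow> z \<in> K \<Longrightarrow>
           (1 - \<eta>) * U * z n \<le> (\<Sum>i\<in>{..<n} - A. min (s i) U * z i)"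
proof -
  define M where "M = {i. i < n \<and> s i \<le> \<theta>}"
  define L where "L = {i. i < n \<and> s i > \<theta>}"
  define \<delta> where "\<delta> = \<eta> * \<theta>"
  define sM where "sM = (\<lambda>i. if i \<in> M then s i else 0)"
  define sL where "sL = (\<lambda>i. if i \<in> L then s i else 0)"
  have sML: "sum s B = sum sM B + sum sL B" if "B \<subseteq> {..<n}" for B
    unfolding sum.distrib[symmetric] using that by (intro sum.cong) (auto simp: sM_def sL_def M_def L_def)
  have "\<forall>\<tau>. \<exists>K. proj_cone (Suc n) K ((2 * (n + 2)) ^ (3 * l) * (2 * n + 1)) \<and>
      (\<forall>B. B \<subseteq> {..<n} \<longrightarrow> D - (real \<tau> + 1) * \<delta> \<le> sum sL B \<longrightarrow> hom_indicator n B \<in> K) \<and>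
      (\<forall>B. B \<subseteq> {..<n} \<longrightarrow> sum sL B < D - (real \<tau> + 1) * \<delta> \<longrightarrow> K \<subseteq> {z. z n \<le> (\<Sum>i\<in>{..<n} - B. z i)})"
  proof
    fix \<tau> :: nat
    show "\<exists>K. proj_cone (Suc n) K ((2 * (n + 2)) ^ (3 * l) * (2 * n + 1)) \<and>
      (\<forall>B. B \<subseteq> {..<n} \<longrightarrow> D - (real \<tau> + 1) * \<delta> \<le> sum sL B \<longrightarrow> hom_indicator n B \<in> K) \<and>
      (\<forall>B. B \<subseteq> {..<n} \<longrightarrow> sum sL B < D - (real \<tau> + 1) * \<delta> \<longrightarrow> K \<subseteq> {z. z n \<le> (\<Sum>i\<in>{..<n} - B. z i)})"
    proof (rule threshold_cone[OF _ l])
      show "\<And>i. i < n \<Longrightarrow> sL i \<ge> 0" using s by (simp add: sL_def less_imp_le)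
      fix K assume "proj_cone (Suc n) K ((2 * (n + 2)) ^ (3 * l) * (2 * n + 1))"
        and "\<And>B. B \<subseteq> {..<n} \<Longrightarrow> D - (real \<tau> + 1) * \<delta> \<le> sum sL B \<Longrightarrow> hom_indicator n B \<in> K"
        and "\<And>B. B \<subseteq> {..<n} \<Longrightarrow> sum sL B < D - (real \<tau> + 1) * \<delta> \<Longrightarrow> K \<subseteq> {z. z n \<le> (\<Sum>i\<in>{..<n} - B. z i)}"
      then show ?thesis by (intro exI[of _ K]) simp
    qed
  qed
  then obtain T where "\<forall>\<tau>. proj_cone (Suc n) (T \<tau>) ((2 * (n + 2)) ^ (3 * l) * (2 * n + 1)) \<and>
      (\<forall>B. B \<subseteq> {..<n} \<longrightarrow> D - (real \<tau> + 1) * \<delta> \<le> sum sL B \<longrightarrow> hom_indicator n B \<in> T \<tau>) \<and>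
      (\<forall>B. B \<subseteq> {..<n} \<longrightarrow> sum sL B < D - (real \<tau> + 1) * \<delta> \<longrightarrow> T \<tau> \<subseteq> {z. z n \<le> (\<Sum>i\<in>{..<n} - B. z i)})"
    by (rule choice[THEN exE])
  then have T: "\<And>\<tau>. proj_cone (Suc n) (T \<tau>) ((2 * (n + 2)) ^ (3 * l) * (2 * n + 1))"
    and T_in: "\<And>\<tau> B. B \<subseteq> {..<n} \<Longrightarrow> D - (real \<tau> + 1) * \<delta> \<le> sum sL B \<Longrightarrow> hom_indicator n B \<in> T \<tau>"
    and T_sep: "\<And>\<tau> B. B \<subseteq> {..<n} \<Longrightarrow> sum sL B < D - (real \<tau> + 1) * \<delta> \<Longrightarrow> T \<tau> \<subseteq> {z. z n \<le> (\<Sum>i\<in>{..<n} - B. z i)}"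
    by simp_all
  define C where "C = (\<lambda>\<tau>. knap_cone n sM (real \<tau> * \<delta>) \<inter> T \<tau>)"
  have C: "proj_cone (Suc n) (C \<tau>) ((2 * n + 1) * ((2 * (n + 2)) ^ (3 * l) + 1))" for \<tau>
    using proj_cone_Int[OF proj_cone_knap_cone[of n sM "real \<tau> * \<delta>"] T[of \<tau>]] 
    by (simp add: C_def algebra_simps)
  show ?thesis
  proof (rule that[of "mink_sum_upto C q"])
    show "proj_cone (Suc n) (mink_sum_upto C q) (Suc q * ((2 * n + 1) * ((2 * (n + 2)) ^ (3 * l) + 1)))"
      by (intro proj_cone_mink_sum_upto C)
  next
    fix B assume B: "B \<subseteq> {..<n}" "D \<le> sum s B"
    obtain \<tau> where \<tau>: "\<tau> \<le> q" "real \<tau> * \<delta> \<le> sum sM B" "sum sM B \<le> (real \<tau> + 1) * \<delta>"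
    \<comment> \<open>For \<theta> = 0 the step \<delta> is 0, but sizes are positive, so no item is
      small and the guess 0 is right. Otherwise \<tau> is the rounded-down quotient by
      \<delta>.\<close>
    proof (cases "\<theta> = 0")
      case True
      have "sum sM B = 0" using True s B(1) by (intro sum.neutral) (force simp: sM_def M_def)
      then show ?thesis using True by (intro that[of 0]) (auto simp: \<delta>_def)
    next
      case False
      then have "\<delta> > 0" using \<theta> \<eta> by (simp add: \<delta>_def)
      have sM0: "sum sM B \<ge> 0" using s B(1) by (intro sum_nonneg) (auto simp: sM_def M_def less_imp_le)
      have "sum sM B \<le> real (card B) * \<theta>"
        using \<theta> by (intro sum_bounded_above) (auto simp: sM_def M_def)
      also have "\<dots> \<le> real n * \<theta>" using card_mono[OF _ B(1)] \<theta> by (intro mult_right_mono) auto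
      also have "\<dots> \<le> (\<eta> * real q) * \<theta>" using q \<theta> by (intro mult_right_mono) auto
      finally have "sum sM B / \<delta> \<le> real q" using \<open>\<delta> > 0\<close> by (simp add: \<delta>_def field_simps)
      moreover define \<tau> where "\<tau> = nat \<lfloor>sum sM B / \<delta>\<rfloor>"
      have "0 \<le> sum sM B / \<delta>" using sM0 \<open>\<delta> > 0\<close> by simp
      then have "real \<tau> \<le> sum sM B / \<delta>" "sum sM B / \<delta> \<le> real \<tau> + 1"
        unfolding \<tau>_def by linarith+
      moreover from calculation have "\<tau> \<le> q" by linarith
      ultimately show ?thesis using \<open>\<delta> > 0\<close> by (intro that[of \<tau>]) (auto simp: field_simps)
    qed
    have "D - (real \<tau> + 1) * \<delta> \<le> sum sL B" using B \<tau>(3) sML[of B] by simp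
    then have "hom_indicator n B \<in> C \<tau>"
      unfolding C_def using B \<tau>(2) T_in by (auto intro: hom_indicator_in_knap_cone)
    moreover have "C \<tau> \<subseteq> mink_sum_upto C q"
      using \<tau>(1) by (intro mink_sum_upto_superset proj_cone_zero[OF C])
    ultimately show "hom_indicator n B \<in> mink_sum_upto C q" by blast
  next
    fix A z U
    assume A: "A \<subseteq> {..<n}" and AU: "sum s A = D - U" and U: "U > 0" "\<theta> \<le> U"
      and \<theta>max: "\<And>i. i < n \<Longrightarrow> s i \<le> U \<Longrightarrow> s i \<le> \<theta>" and z: "z \<in> mink_sum_upto C q"
    let ?V = "{z. (1 - \<eta>) * U * z n \<le> (\<Sum>i\<in>{..<n} - A. min (s i) U * z i)}"
    have "mink_sum_upto C q \<subseteq> ?V"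
    proof (rule mink_sum_upto_subset)
      fix u v assume "u \<in> ?V" "v \<in> ?V"
      then show "(\<lambda>j. u j + v j) \<in> ?V" by (simp add: distrib_left sum.distrib)
    next
      fix \<tau>
      show "C \<tau> \<subseteq> ?V"
      proof
        fix z assume z: "z \<in> C \<tau>"
        then have z0: "0 \<le> z j" "z j \<le> z n" if "j < n" for j
          using that by (auto simp: C_def knap_cone_def)
        have zn: "z n \<ge> 0" using z0[of 0] n by simp
        show "z \<in> ?V"
        proof (cases "sum sL A < D - (real \<tau> + 1) * \<delta>")
          case True
          \<comment> \<open>Small items carry no weight in \<open>sL\<close>, so adding all of them
            to \<open>A\<close> still misses the threshold. The separation then involves large items
            only, and these have size above \<open>U\<close>, hence truncated size
            \<open>U\<close>.\<close>
          have "sum sL (A \<union> M) = sum sL A"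
            using A finite_subset[OF A] by (intro sum.mono_neutral_right) (auto simp: sL_def L_def M_def)
          then have "z n \<le> (\<Sum>i\<in>{..<n} - (A \<union> M). z i)"
            using T_sep[of "A \<union> M" \<tau>] True A z by (auto simp: C_def M_def)
          then have "U * z n \<le> U * (\<Sum>i\<in>{..<n} - (A \<union> M). z i)"
            using U by (intro mult_left_mono) auto
          also have "\<dots> = (\<Sum>i\<in>{..<n} - (A \<union> M). min (s i) U * z i)"
            unfolding sum_distrib_left using \<theta>max
            by (intro sum.cong) (auto simp: M_def min_def)
          also have "\<dots> \<le> (\<Sum>i\<in>{..<n} - A. min (s i) U * z i)"
            using z0 s U by (intro sum_mono2) (auto simp: less_imp_le)
          finally have "U * z n \<le> (\<Sum>i\<in>{..<n} - A. min (s i) U * z i)" .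
          moreover have "(1 - \<eta>) * U * z n \<le> 1 * U * z n"
            using \<eta> U zn by (intro mult_right_mono) auto
          ultimately show ?thesis by simp
        next
          case False
          \<comment> \<open>Here \<theta> \<le> \<open>U\<close> is what turns the additive
            precision \<delta> into a relative error \<eta>.\<close>
          have "(1 - \<eta>) * U \<le> U - \<delta>"
            using U(2) \<eta> by (simp add: \<delta>_def algebra_simps)
          also have "\<dots> \<le> real \<tau> * \<delta> - sum sM A"
            using False AU sML[OF A] by (simp add: algebra_simps)
          finally have "(1 - \<eta>) * U * z n \<le> (real \<tau> * \<delta> - sum sM A) * z n"
            using zn by (rule mult_right_mono)
          also have "\<dots> \<le> (\<Sum>i\<in>{..<n} - A. sM i * z i)"
            using z A s by (intro knap_cone_residual) (auto simp: C_def sM_def less_imp_le M_def)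
          also have "\<dots> \<le> (\<Sum>i\<in>{..<n} - A. min (s i) U * z i)"
            using z0 s U by (intro sum_mono mult_right_mono) (auto simp: sM_def M_def min_def less_imp_le)
          finally show ?thesis by simp
        qed
      qed
    qed
    then show "(1 - \<eta>) * U * z n \<le> (\<Sum>i\<in>{..<n} - A. min (s i) U * z i)" using z by blast
  qed
qed

section \<open>From cones back to polyhedra, and the rounding of their points\<close>

lemma proj_cone_add:
  assumes "proj_cone N K m" "v \<in> K" "w \<in> K"
  shows "(\<lambda>j. v j + w j) \<in> K"
proof -
  from assms(1) obtain k :: nat and A B where K: "K = {z. \<exists>y. \<forall>i<m.
     (\<Sum>j<N. A i j * z j) + (\<Sum>j<k. B i j * y j) \<ge> (0::real)}" unfolding proj_cone_def by blast
  from assms(2,3) obtain y y' where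
    "\<forall>i<m. (\<Sum>j<N. A i j * v j) + (\<Sum>j<k. B i j * y j) \<ge> 0"
    "\<forall>i<m. (\<Sum>j<N. A i j * w j) + (\<Sum>j<k. B i j * y' j) \<ge> 0" unfolding K by blast
  then have "\<forall>i<m. (\<Sum>j<N. A i j * (v j + w j)) + (\<Sum>j<k. B i j * (y j + y' j)) \<ge> 0"
    by (force simp: distrib_left sum.distrib)
  then show ?thesis unfolding K by (auto intro: exI[of _ "\<lambda>j. y j + y' j"])
qed

lemma proj_cone_scale:
  assumes "proj_cone N K m" "v \<in> K" "0 \<le> r"
  shows "(\<lambda>j. r * v j) \<in> K"
proof -
  from assms(1) obtain k :: nat and A B where K: "K = {z. \<exists>y. \<forall>i<m.
     (\<Sum>j<N. A i j * z j) + (\<Sum>j<k. B i j * y j) \<ge> (0::real)}" unfolding proj_cone_def by blast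
  from assms(2) obtain y where
    y: "\<forall>i<m. (\<Sum>j<N. A i j * v j) + (\<Sum>j<k. B i j * y j) \<ge> 0" unfolding K by blast
  have "(\<Sum>j<N. A i j * (r * v j)) + (\<Sum>j<k. B i j * (r * y j)) \<ge> 0" if "i < m" for i
  proof -
    have "(\<Sum>j<N. A i j * (r * v j)) + (\<Sum>j<k. B i j * (r * y j)) =
        r * ((\<Sum>j<N. A i j * v j) + (\<Sum>j<k. B i j * y j))"
      by (simp add: distrib_left sum_distrib_left mult.left_commute)
    then show ?thesis using y that assms(3) by simp
  qed
  then show ?thesis unfolding K by (auto intro: exI[of _ "\<lambda>j. r * y j"])
qed

lemma proj_cone_conic_combination:
  assumes "proj_cone N K m" "finite S" "\<And>v. v \<in> S \<Longrightarrow> f v \<in> K" "\<And>v. v \<in> S \<Longrightarrow> 0 \<le> u v"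
  shows "(\<lambda>j. \<Sum>v\<in>S. u v * f v j) \<in> K"
  using assms(2-4)
proof (induction S rule: finite_induct)
  case empty
  then show ?case using proj_cone_zero[OF assms(1)] by simp
next
  case (insert v S)
  then show ?case
    using proj_cone_add[OF assms(1) proj_cone_scale[OF assms(1), of "f v" "u v"], of "\<lambda>j. \<Sum>v\<in>S. u v * f v j"]
    by simp
qed

text \<open>Dehomogenisation: fixing coordinate \<open>n\<close> to 1 moves its column to the
  right-hand side, and negation turns the inequalities around.\<close>

lemma ext_form_proj_of_proj_cone:
  assumes "proj_cone (Suc n) K m"
  shows "\<exists>k Ele Fle gle. ext_form_proj n k m 0 Ele Fle gle Eeq Feq geq =
    {x. (\<forall>j\<ge>n. x j = 0) \<and> x(n := 1) \<in> K}"
proof -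
  from assms obtain k :: nat and A B where K: "K = {z. \<exists>y. \<forall>i<m.
     (\<Sum>j<Suc n. A i j * z j) + (\<Sum>j<k. B i j * y j) \<ge> (0::real)}" unfolding proj_cone_def by blast
  have "(\<Sum>j<Suc n. A i j * (x(n := 1)) j) = (\<Sum>j<n. A i j * x j) + A i n" for i x
    by simp
  then have "(\<Sum>j<Suc n. A i j * (x(n := 1)) j) + (\<Sum>j<k. B i j * y j) \<ge> 0 \<longleftrightarrow>
      (\<Sum>j<n. - A i j * x j) + (\<Sum>j<k. - B i j * y j) \<le> A i n" for i x y
    by (simp only: mult_minus_left sum_negf) linarith
  then have "x(n := 1) \<in> K \<longleftrightarrow> (\<exists>y. \<forall>i<m. (\<Sum>j<n. - A i j * x j) + (\<Sum>j<k. - B i j * y j) \<le> A i n)" for x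
    unfolding K mem_Collect_eq by simp
  then show ?thesis
    by (intro exI[of _ k] exI[of _ "\<lambda>i j. - A i j"] exI[of _ "\<lambda>i j. - B i j"] exI[of _ "\<lambda>i. A i n"])
      (simp add: ext_form_proj_def)
qed

text \<open>Convex weights sum to 1, so a convex combination of feasible points lifts to a conic
  combination of their indicators with last coordinate 1, and \<open>K\<close> is closed under
  these.\<close>

lemma knap_polytope_subset:
  assumes K: "proj_cone (Suc n) K m"
    and "\<And>B. B \<subseteq> {..<n} \<Longrightarrow> D \<le> sum s B \<Longrightarrow> hom_indicator n B \<in> K"
  shows "knap_polytope n s D \<subseteq> {x. (\<forall>j\<ge>n. x j = 0) \<and> x(n := 1) \<in> K}"
proof
  fix x assume "x \<in> knap_polytope n s D"
  then obtain S u where S: "finite S" "S \<subseteq> knap_feasible n s D" "\<forall>v\<in>S. u v \<ge> 0"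
    "(\<Sum>v\<in>S. u v) = 1" and x: "x = (\<lambda>j. \<Sum>v\<in>S. u v * v j)"
    unfolding knap_polytope_def by blast
  have "v(n := 1) \<in> K" if "v \<in> S" for v
  proof -
    from that S(2) have v: "\<forall>j<n. v j \<in> {0, 1}" "\<forall>j\<ge>n. v j = 0" "(\<Sum>j<n. s j * v j) \<ge> D"
      unfolding knap_feasible_def by auto
    define B where "B = {j. j < n \<and> v j = 1}"
    have B: "B \<subseteq> {..<n}" by (auto simp: B_def)
    have eq: "v(n := 1) = hom_indicator n B"
      using v(1,2) by (auto simp: fun_eq_iff hom_indicator_def B_def not_less[symmetric])
    have "sum s B = (\<Sum>j<n. s j * (v(n := 1)) j)"
      unfolding eq using B by (simp add: sum_mult_hom_indicator)
    also have "\<dots> = (\<Sum>j<n. s j * v j)" by (intro sum.cong) auto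
    finally have "D \<le> sum s B" using v(3) by simp
    then show ?thesis using assms(2) B eq by simp
  qed
  then have "(\<lambda>j. \<Sum>v\<in>S. u v * (v(n := 1)) j) \<in> K"
    using S by (intro proj_cone_conic_combination[OF K]) (auto simp del: fun_upd_apply)
  moreover have "(\<lambda>j. \<Sum>v\<in>S. u v * (v(n := 1)) j) = x(n := 1)"
    using S(4) by (auto simp: x fun_eq_iff)
  moreover have "x j = 0" if "j \<ge> n" for j
    unfolding x using S(2) that by (intro sum.neutral) (auto simp: knap_feasible_def)
  ultimately show "x \<in> {x. (\<forall>j\<ge>n. x j = 0) \<and> x(n := 1) \<in> K}" by simp
qed

lemma Inf_knap_cost_le:
  assumes c: "\<And>j. j < n \<Longrightarrow> 0 \<le> c j" and B: "B \<subseteq> {..<n}" "D \<le> sum s B"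
  shows "Inf (lin_cost n c ` knap_polytope n s D) \<le> sum c B"
proof -
  define b :: "nat \<Rightarrow> real" where "b = (\<lambda>j. of_bool (j \<in> B))"
  have sum_b: "(\<Sum>j<n. f j * b j) = sum f B" for f :: "nat \<Rightarrow> real"
  proof -
    have "(\<Sum>j<n. f j * b j) = (\<Sum>j<n. f j * hom_indicator n B j)"
      by (intro sum.cong) (auto simp: b_def hom_indicator_def)
    then show ?thesis using sum_mult_hom_indicator[OF B(1)] by simp
  qed
  have "b \<in> knap_feasible n s D"
    using B by (auto simp: knap_feasible_def sum_b) (auto simp: b_def)
  then have "b \<in> knap_polytope n s D"
    unfolding knap_polytope_def by (intro CollectI exI[of _ "{b}"] exI[of _ "\<lambda>_. 1"]) auto
  \<comment> \<open>Nonnegative costs bound the image from below, without which \<open>Inf\<close>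
    would not be a lower bound.\<close>
  moreover have "0 \<le> lin_cost n c x" if x: "x \<in> knap_polytope n s D" for x
  proof -
    obtain S u where S: "S \<subseteq> knap_feasible n s D" "\<forall>v\<in>S. u v \<ge> 0"
      and x: "x = (\<lambda>j. \<Sum>v\<in>S. u v * v j)" using x unfolding knap_polytope_def by blast
    have "v j \<ge> 0" if "v \<in> S" "j < n" for v j
    proof -
      have "v j \<in> {0, 1}" using S(1) that by (auto simp: knap_feasible_def)
      then show ?thesis by auto
    qed
    then show ?thesis
      unfolding lin_cost_def x using S(2) c by (intro sum_nonneg mult_nonneg_nonneg) auto
  qed
  then have "bdd_below (lin_cost n c ` knap_polytope n s D)" by (intro bdd_belowI2)
  ultimately have "Inf (lin_cost n c ` knap_polytope n s D) \<le> lin_cost n c b"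
    by (intro cInf_lower) auto
  then show ?thesis by (simp add: lin_cost_def sum_b)
qed

text \<open>Items with \<open>(2 + \<epsilon>) * x i \<ge> 1\<close> are bought and paid for by the
  scaled point. On the remaining items the scaled point stays below 1 and covers twice the residual
  demand in truncated sizes, as the exchange rounding requires.\<close>

lemma knapsack_cover_rounding:
  fixes s c x :: "nat \<Rightarrow> real"
  assumes s: "\<And>i. i < n \<Longrightarrow> s i > 0" and \<epsilon>: "0 < \<epsilon>" "\<epsilon> < 1"
    and c: "\<And>j. j < n \<Longrightarrow> 0 \<le> c j" and x: "\<And>j. j < n \<Longrightarrow> 0 \<le> x j"
    and kc: "\<And>A U. A \<subseteq> {..<n} \<Longrightarrow> sum s A = D - U \<Longrightarrow> U > 0 \<Longrightarrow>
      (1 - \<epsilon> / 3) * U \<le> (\<Sum>i\<in>{..<n} - A. min (s i) U * x i)"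
  shows "\<exists>B\<subseteq>{..<n}. D \<le> sum s B \<and> sum c B \<le> (2 + \<epsilon>) * (\<Sum>j<n. c j * x j)"
proof -
  define A where "A = {i. i < n \<and> (2 + \<epsilon>) * x i \<ge> 1}"
  have A: "A \<subseteq> {..<n}" "finite A" by (auto simp: A_def)
  have "c i \<le> (2 + \<epsilon>) * (c i * x i)" if "i \<in> A" for i
    using that c[of i] mult_left_mono[of 1 "(2 + \<epsilon>) * x i" "c i"] by (simp add: A_def mult.left_commute)
  then have cA: "sum c A \<le> (2 + \<epsilon>) * (\<Sum>j\<in>A. c j * x j)"
    unfolding sum_distrib_left by (rule sum_mono)
  have split: "(\<Sum>j<n. c j * x j) = (\<Sum>j\<in>{..<n} - A. c j * x j) + (\<Sum>j\<in>A. c j * x j)"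
    using A by (intro sum.subset_diff) auto
  have rest: "(\<Sum>j\<in>{..<n} - A. c j * x j) \<ge> 0" using c x by (intro sum_nonneg) auto
  show ?thesis
  proof (cases "D \<le> sum s A")
    case True
    have "sum c A \<le> (2 + \<epsilon>) * (\<Sum>j<n. c j * x j)"
      using cA rest \<epsilon> unfolding split by (simp add: distrib_left add_increasing)
    then show ?thesis using True A by blast
  next
    case False
    define U where "U = D - sum s A"
    have U: "U > 0" "sum s A = D - U" using False by (auto simp: U_def)
    \<comment> \<open>The product equals \<open>2 + \<epsilon> * (1 - \<epsilon>) / 3\<close>, which
      explains the precision \<open>\<epsilon> / 3\<close>.\<close>
    have "(2 + \<epsilon>) * (1 - \<epsilon> / 3) \<ge> 2"
      using \<epsilon> mult_mono[of \<epsilon> 1 \<epsilon> 1] by (simp add: algebra_simps)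
    then have "2 * U \<le> (2 + \<epsilon>) * (1 - \<epsilon> / 3) * U" using U(1) by (intro mult_right_mono) auto
    also have "\<dots> = (2 + \<epsilon>) * ((1 - \<epsilon> / 3) * U)" by simp
    also have "\<dots> \<le> (2 + \<epsilon>) * (\<Sum>i\<in>{..<n} - A. min (s i) U * x i)"
      using kc[OF A(1) U(2,1)] \<epsilon> by (intro mult_left_mono) auto
    also have "\<dots> = (\<Sum>i\<in>{..<n} - A. min (s i) U * ((2 + \<epsilon>) * x i))"
      by (simp add: sum_distrib_left mult.left_commute)
    finally have "\<exists>F\<subseteq>{..<n} - A. (\<Sum>i\<in>F. min (s i) U) \<ge> U \<and>
        sum c F \<le> (\<Sum>i\<in>{..<n} - A. c i * ((2 + \<epsilon>) * x i))"
      using s c x U(1) \<epsilon> by (intro knapsack_exchange_rounding) (auto simp: A_def less_imp_le)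
    then obtain F where F: "F \<subseteq> {..<n} - A" "(\<Sum>i\<in>F. min (s i) U) \<ge> U"
        "sum c F \<le> (\<Sum>i\<in>{..<n} - A. c i * ((2 + \<epsilon>) * x i))" by blast
    have un: "sum f (A \<union> F) = sum f A + sum f F" for f :: "nat \<Rightarrow> real"
      using F(1) A finite_subset[OF F(1)] by (intro sum.union_disjoint) auto
    have "(\<Sum>i\<in>F. min (s i) U) \<le> sum s F" by (intro sum_mono) simp
    then have "D \<le> sum s (A \<union> F)" using F(2) U(2) by (simp add: un)
    moreover have "(\<Sum>i\<in>{..<n} - A. c i * ((2 + \<epsilon>) * x i)) = (2 + \<epsilon>) * (\<Sum>j\<in>{..<n} - A. c j * x j)"
      by (simp add: sum_distrib_left mult.left_commute)
    then have "sum c (A \<union> F) \<le> (2 + \<epsilon>) * (\<Sum>j<n. c j * x j)"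
      using F(3) cA unfolding un split by (simp add: distrib_left)
    moreover have "A \<union> F \<subseteq> {..<n}" using A F(1) by blast
    ultimately show ?thesis by blast
  qed
qed

text \<open>Powers of \<open>n\<close> absorb all linear factors, leaving
  \<open>n ^ (9 * l + 10) / \<epsilon>\<close>. Then \<open>9 * l + 10 \<le> 19 * l\<close>, and
  \<open>2 ^ l \<le> n ^ 2\<close> gives \<open>l \<le> 4 * ln n\<close>, whence 76 = 19 *
  4.\<close>

lemma knapsack_cone_size_bound:
  fixes n q l :: nat and \<epsilon> :: real
  assumes n: "n \<ge> 2" and \<epsilon>: "0 < \<epsilon>" "\<epsilon> < 1" and q: "real q \<le> 3 * real n / \<epsilon> + 1"
    and l: "1 \<le> l" "2 ^ l \<le> 2 * n"
  shows "real (2 * n + 1 + Suc n * (Suc q * ((2 * n + 1) * ((2 * (n + 2)) ^ (3 * l) + 1))))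
    \<le> (1 / \<epsilon>) powr 76 * real n powr (76 * ln (real n))"
proof -
  define N where "N = real n"
  have N: "N \<ge> 2" using n by (simp add: N_def)
  have NN: "N * N \<ge> 2 * N" using N by (intro mult_right_mono) auto
  have NNN: "N ^ 3 \<ge> 4 * N"
  proof -
    have "4 * N \<le> 2 * N * N" using NN by linarith
    also have "\<dots> \<le> N * N * N" using NN N by (intro mult_right_mono) auto
    finally show ?thesis by (simp add: power3_eq_cube)
  qed
  have q': "real (Suc q) \<le> N ^ 3 / \<epsilon>"
  proof -
    have "real (Suc q) \<le> 3 * N / \<epsilon> + 2" using q by (simp add: N_def)
    also have "2 \<le> N / \<epsilon>" using N \<epsilon> by (simp add: field_simps)
    also have "3 * N / \<epsilon> + N / \<epsilon> = 4 * N / \<epsilon>" by (simp add: field_simps)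
    also have "\<dots> \<le> N ^ 3 / \<epsilon>" using NNN \<epsilon> by (intro divide_right_mono) auto
    finally show ?thesis by simp
  qed
  have "real ((2 * (n + 2)) ^ (3 * l) + 1) \<le> (N ^ 3) ^ (3 * l) + (N ^ 3) ^ (3 * l)"
  proof -
    have "real ((2 * (n + 2)) ^ (3 * l)) = (2 * (N + 2)) ^ (3 * l)" by (simp only: N_def of_nat_power of_nat_mult of_nat_add of_nat_numeral)
    also have "\<dots> \<le> (N ^ 3) ^ (3 * l)" using N NNN by (intro power_mono) auto
    moreover have "1 \<le> (N ^ 3) ^ (3 * l)" using N by (intro one_le_power) auto
    ultimately show ?thesis by simp
  qed
  also have "\<dots> = 2 * N ^ (9 * l)" by (simp add: power_mult[symmetric])
  also have "\<dots> \<le> N * N ^ (9 * l)" using N by (intro mult_right_mono) auto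
  finally have pw: "real ((2 * (n + 2)) ^ (3 * l) + 1) \<le> N ^ (9 * l + 1)" by simp
  have n2: "real (2 * n + 1) \<le> N ^ 3" using N NNN by (simp add: N_def)
  have n1: "real (Suc n) \<le> N ^ 2"
  proof -
    have "real (Suc n) = N + 1" by (simp add: N_def)
    also have "\<dots> \<le> N * N" using N NN by linarith
    finally show ?thesis by (simp add: power2_eq_square)
  qed
  have "real (Suc n * (Suc q * ((2 * n + 1) * ((2 * (n + 2)) ^ (3 * l) + 1))))
     = real (Suc n) * (real (Suc q) * (real (2 * n + 1) * real ((2 * (n + 2)) ^ (3 * l) + 1)))"
    by (simp only: of_nat_mult)
  also have "\<dots> \<le> N ^ 2 * (N ^ 3 / \<epsilon> * (N ^ 3 * N ^ (9 * l + 1)))"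
    using n1 q' n2 pw N \<epsilon> by (intro mult_mono) (auto intro!: mult_nonneg_nonneg)
  also have "\<dots> = 1 / \<epsilon> * N ^ (9 * l + 9)"
    by (simp add: power_add[symmetric] numeral_eq_Suc)
  finally have 1: "real (Suc n * (Suc q * ((2 * n + 1) * ((2 * (n + 2)) ^ (3 * l) + 1))))
    \<le> 1 / \<epsilon> * N ^ (9 * l + 9)" .
  have "real (2 * n + 1) \<le> 1 * N ^ 3" using n2 by simp
  also have "\<dots> \<le> 1 / \<epsilon> * N ^ (9 * l + 9)"
    using N \<epsilon> by (intro mult_mono power_increasing) auto
  finally have "real (2 * n + 1 + Suc n * (Suc q * ((2 * n + 1) * ((2 * (n + 2)) ^ (3 * l) + 1))))
     \<le> 2 * (1 / \<epsilon> * N ^ (9 * l + 9))" using 1 unfolding of_nat_add by linarith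
  also have "\<dots> \<le> N * (1 / \<epsilon> * N ^ (9 * l + 9))" using N \<epsilon> by (intro mult_right_mono) auto
  also have "\<dots> = 1 / \<epsilon> * N ^ (9 * l + 10)"
  proof -
    have eq: "9 * l + 10 = Suc (9 * l + 9)" by simp
    show ?thesis unfolding eq power_Suc by (rule mult.left_commute)
  qed
  also have "\<dots> \<le> (1 / \<epsilon>) powr 76 * N powr (76 * ln N)"
  proof (rule mult_mono)
    show "1 / \<epsilon> \<le> (1 / \<epsilon>) powr 76" using \<epsilon> powr_mono[of 1 76 "1 / \<epsilon>"] by simp
    have "real l * ln 2 \<le> 2 * ln N"
    proof -
      have "real (2 ^ l) \<le> N * N" using l(2) NN unfolding N_def by linarith
      then have "ln ((2::real) ^ l) \<le> ln (N * N)" using N by (intro ln_mono) auto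
      then show ?thesis using N by (simp add: ln_realpow ln_mult)
    qed
    moreover have "real l * (1 / 2) \<le> real l * ln 2"
      using ln2_ge_two_thirds by (intro mult_left_mono) auto
    ultimately have "real (19 * l) \<le> 76 * ln N" by simp
    then have "N powr real (19 * l) \<le> N powr (76 * ln N)" using N by (intro powr_mono) auto
    moreover have "N ^ (9 * l + 10) \<le> N ^ (19 * l)" using N l(1) by (intro power_increasing) auto
    moreover have "N powr real (19 * l) = N ^ (19 * l)" using N by (intro powr_realpow) auto
    ultimately show "N ^ (9 * l + 10) \<le> N powr (76 * ln N)" by linarith
  qed (use N \<epsilon> in auto)
  finally show ?thesis by (simp only: N_def)
qed

section \<open>Intersecting the cones of all scales\<close>

theorem theorem1:
  shows "\<exists>C::real. C > 0 \<and>
    (\<forall>(\<epsilon>::real) (n::nat) (s::nat \<Rightarrow> real) (D::real).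
       0 < \<epsilon> \<and> \<epsilon> < 1 \<and> n \<ge> 2 \<and> (\<forall>i<n. s i > 0) \<and> D > 0 \<and>
       knap_feasible n s D \<noteq> {} \<longrightarrow>
       (\<exists>k m p Ele Fle gle Eeq Feq geq.
          real m \<le> (1 / \<epsilon>) powr C * real n powr (C * ln (real n)) \<and>
          knap_polytope n s D \<subseteq> ext_form_proj n k m p Ele Fle gle Eeq Feq geq \<and>
          (\<forall>c::nat \<Rightarrow> real. (\<forall>j<n. c j \<ge> 0) \<longrightarrow>
             (\<forall>x \<in> ext_form_proj n k m p Ele Fle gle Eeq Feq geq.
                Inf (lin_cost n c ` knap_polytope n s D) \<le> (2 + \<epsilon>) * lin_cost n c x))))"
proof (intro exI[of _ "76 :: real"] conjI allI impI; (elim conjE)?)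
  fix \<epsilon> D :: real and n :: nat and s :: "nat \<Rightarrow> real"
  assume \<epsilon>: "0 < \<epsilon>" "\<epsilon> < 1" and n: "n \<ge> 2" and s: "\<forall>i<n. s i > 0"
  obtain l where l: "1 \<le> l" "n + 1 \<le> 2 ^ l" "2 ^ l \<le> 2 * n"
  proof -
    obtain i where "2 ^ i \<le> n" "n < 2 ^ (i + 1)" using ex_power_ivl1[of 2 n] n by auto
    then show ?thesis by (intro that[of "Suc i"]) auto
  qed
  \<comment> \<open>Enough guesses of step \<open>\<epsilon> / 3\<close> times \<theta> to reach
    \<open>n\<close> times \<theta>, the largest possible weight of the small items.\<close>
  define q where "q = nat \<lceil>3 * real n / \<epsilon>\<rceil>"
  have "0 \<le> 3 * real n / \<epsilon>" using \<epsilon> by simp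
  then have q: "3 * real n / \<epsilon> \<le> real q" "real q \<le> 3 * real n / \<epsilon> + 1"
    unfolding q_def by linarith+
  have q': "real n \<le> \<epsilon> / 3 * real q" using q(1) \<epsilon> by (simp add: field_simps)
  \<comment> \<open>Index \<open>n\<close> stands for the scale 0, used when the residual demand is
    below every item size.\<close>
  define \<theta> where "\<theta> = (\<lambda>k. if k < n then s k else 0)"
  define M where "M = Suc q * ((2 * n + 1) * ((2 * (n + 2)) ^ (3 * l) + 1))"
  have "\<forall>k. \<exists>K. proj_cone (Suc n) K M \<and>
      (\<forall>B. B \<subseteq> {..<n} \<longrightarrow> D \<le> sum s B \<longrightarrow> hom_indicator n B \<in> K) \<and>
      (\<forall>A z U. A \<subseteq> {..<n} \<longrightarrow> sum s A = D - U \<longrightarrow> U > 0 \<longrightarrow> \<theta> k \<le> U \<longrightarrow>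
           (\<forall>i<n. s i \<le> U \<longrightarrow> s i \<le> \<theta> k) \<longrightarrow> z \<in> K \<longrightarrow>
           (1 - \<epsilon> / 3) * U * z n \<le> (\<Sum>i\<in>{..<n} - A. min (s i) U * z i))" (is "\<forall>k. \<exists>K. ?P k K")
  proof
    fix k
    show "\<exists>K. ?P k K"
    proof (rule knapsack_level_cone[of n s l "\<epsilon> / 3" "\<theta> k" q D])
      show "0 \<le> \<theta> k" using s by (simp add: \<theta>_def less_imp_le)
      fix K assume "proj_cone (Suc n) K (Suc q * ((2 * n + 1) * ((2 * (n + 2)) ^ (3 * l) + 1)))"
        and "\<And>B. B \<subseteq> {..<n} \<Longrightarrow> D \<le> sum s B \<Longrightarrow> hom_indicator n B \<in> K"
        and "\<And>A z U. A \<subseteq> {..<n} \<Longrightarrow> sum s A = D - U \<Longrightarrow> U > 0 \<Longrightarrow> \<theta> k \<le> U \<Longrightarrow>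
           (\<And>i. i < n \<Longrightarrow> s i \<le> U \<Longrightarrow> s i \<le> \<theta> k) \<Longrightarrow> z \<in> K \<Longrightarrow>
           (1 - \<epsilon> / 3) * U * z n \<le> (\<Sum>i\<in>{..<n} - A. min (s i) U * z i)"
      then show ?thesis by (intro exI[of _ K]) (simp add: M_def)
    qed (use s n l \<epsilon> q' in auto)
  qed
  then obtain K where K: "\<forall>k. ?P k (K k)" by (rule choice[THEN exE])
  have K_rep: "proj_cone (Suc n) (K k) M"
    and K_in: "B \<subseteq> {..<n} \<Longrightarrow> D \<le> sum s B \<Longrightarrow> hom_indicator n B \<in> K k"
    and K_kc: "A \<subseteq> {..<n} \<Longrightarrow> sum s A = D - U \<Longrightarrow> U > 0 \<Longrightarrow> \<theta> k \<le> U \<Longrightarrow>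
           \<forall>i<n. s i \<le> U \<longrightarrow> s i \<le> \<theta> k \<Longrightarrow> z \<in> K k \<Longrightarrow>
           (1 - \<epsilon> / 3) * U * z n \<le> (\<Sum>i\<in>{..<n} - A. min (s i) U * z i)" for k A B z U
    using K[rule_format, of k] by simp_all
  \<comment> \<open>The first cone is just the homogenised box, which supplies
    \<open>0 \<le> x j\<close>.\<close>
  define R where "R = knap_cone n (\<lambda>_. 0) 0 \<inter> (\<Inter>k\<le>n. K k)"
  have R: "proj_cone (Suc n) R (2 * n + 1 + Suc n * M)"
    unfolding R_def by (intro proj_cone_Int proj_cone_knap_cone proj_cone_Inter_upto K_rep)
  have "hom_indicator n B \<in> R" if "B \<subseteq> {..<n}" "D \<le> sum s B" for B
    unfolding R_def using K_in that by (auto intro: hom_indicator_in_knap_cone)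
  then have sub: "knap_polytope n s D \<subseteq> {x. (\<forall>j\<ge>n. x j = 0) \<and> x(n := 1) \<in> R}"
    by (rule knap_polytope_subset[OF R])
  have gap: "Inf (lin_cost n c ` knap_polytope n s D) \<le> (2 + \<epsilon>) * lin_cost n c x"
    if c: "\<forall>j<n. c j \<ge> 0" and x: "x(n := 1) \<in> R" for c x
  proof -
    have kc: "(1 - \<epsilon> / 3) * U \<le> (\<Sum>i\<in>{..<n} - A. min (s i) U * x i)"
      if A: "A \<subseteq> {..<n}" "sum s A = D - U" "U > 0" for A U
    proof -
      \<comment> \<open>The right scale is the largest item size not exceeding \<open>U\<close>, or
        0 if there is none.\<close>
      have "\<exists>k\<le>n. \<theta> k \<le> U \<and> (\<forall>i<n. s i \<le> U \<longrightarrow> s i \<le> \<theta> k)"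
      proof (cases "{i. i < n \<and> s i \<le> U} = {}")
        case True
        then show ?thesis using A(3) by (intro exI[of _ n]) (auto simp: \<theta>_def)
      next
        case False
        define J where "J = {i. i < n \<and> s i \<le> U}"
        have J: "finite J" "J \<noteq> {}" using False by (auto simp: J_def)
        then have "Max (s ` J) \<in> s ` J" by (intro Max_in) auto
        then obtain k where "k \<in> J" "s k = Max (s ` J)" by auto
        then have k: "k \<in> J" "\<forall>i\<in>J. s i \<le> s k" using J by auto
        then show ?thesis by (intro exI[of _ k]) (auto simp: \<theta>_def J_def)
      qed
      then obtain k where k: "k \<le> n" "\<theta> k \<le> U" "\<forall>i<n. s i \<le> U \<longrightarrow> s i \<le> \<theta> k" by blast
      have "x(n := 1) \<in> K k" using x k(1) by (auto simp: R_def)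
      then have "(1 - \<epsilon> / 3) * U * (x(n := 1)) n \<le> (\<Sum>i\<in>{..<n} - A. min (s i) U * (x(n := 1)) i)"
        using A k by (intro K_kc)
      also have "\<dots> = (\<Sum>i\<in>{..<n} - A. min (s i) U * x i)" by (intro sum.cong) auto
      finally show ?thesis by simp
    qed
    have "0 \<le> x j" if "j < n" for j
      using x that by (auto simp: R_def knap_cone_def split: if_splits)
    then have "\<exists>B\<subseteq>{..<n}. D \<le> sum s B \<and> sum c B \<le> (2 + \<epsilon>) * (\<Sum>j<n. c j * x j)"
      using s \<epsilon> c kc by (intro knapsack_cover_rounding) simp_all
    then obtain B where "B \<subseteq> {..<n}" "D \<le> sum s B" "sum c B \<le> (2 + \<epsilon>) * (\<Sum>j<n. c j * x j)" by blast
    then show ?thesis using Inf_knap_cost_le[of n c B D s] c by (simp add: lin_cost_def)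
  qed
  have size: "real (2 * n + 1 + Suc n * M) \<le> (1 / \<epsilon>) powr 76 * real n powr (76 * ln (real n))"
    unfolding M_def using n \<epsilon> q(2) l(1,3) by (rule knapsack_cone_size_bound)
  obtain k Ele Fle gle where eq: "ext_form_proj n k (2 * n + 1 + Suc n * M) 0 Ele Fle gle
      (\<lambda>_ _. 0) (\<lambda>_ _. 0) (\<lambda>_. 0) = {x. (\<forall>j\<ge>n. x j = 0) \<and> x(n := 1) \<in> R}"
    using ext_form_proj_of_proj_cone[OF R, of "\<lambda>_ _. 0" "\<lambda>_ _. 0" "\<lambda>_. 0"] by (elim exE) (rule that)
  show "\<exists>k m p Ele Fle gle Eeq Feq geq.
          real m \<le> (1 / \<epsilon>) powr 76 * real n powr (76 * ln (real n)) \<and>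
          knap_polytope n s D \<subseteq> ext_form_proj n k m p Ele Fle gle Eeq Feq geq \<and>
          (\<forall>c::nat \<Rightarrow> real. (\<forall>j<n. c j \<ge> 0) \<longrightarrow>
             (\<forall>x \<in> ext_form_proj n k m p Ele Fle gle Eeq Feq geq.
                Inf (lin_cost n c ` knap_polytope n s D) \<le> (2 + \<epsilon>) * lin_cost n c x))"
  proof (intro exI conjI)
    show "real (2 * n + 1 + Suc n * M) \<le> (1 / \<epsilon>) powr 76 * real n powr (76 * ln (real n))"
      by (rule size)
    show "knap_polytope n s D \<subseteq> ext_form_proj n k (2 * n + 1 + Suc n * M) 0 Ele Fle gle
        (\<lambda>_ _. 0) (\<lambda>_ _. 0) (\<lambda>_. 0)"
      unfolding eq by (rule sub)
    show "\<forall>c::nat \<Rightarrow> real. (\<forall>j<n. c j \<ge> 0) \<longrightarrow>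
       (\<forall>x \<in> ext_form_proj n k (2 * n + 1 + Suc n * M) 0 Ele Fle gle
            (\<lambda>_ _. 0) (\<lambda>_ _. 0) (\<lambda>_. 0).
          Inf (lin_cost n c ` knap_polytope n s D) \<le> (2 + \<epsilon>) * lin_cost n c x)"
      unfolding eq using gap by simp
  qed
qed simp

end
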